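(* Let $(M, g, \boldsymbol{\tau})$ be a spacetime. Then the null tangent bundle $\mathcal{N}M$, with the projection $\pi : \mathcal{N}M \rightarrow M$, $(p,v) \mapsto p$, is a smooth fibre bundle whose typical fibre is the split null cone, $\pi^{-1}(p) \simeq \mathcal{C}_0 = \mathcal{C}_0^+ \cup \mathcal{C}_0^-$.
   Context: A spacetime $(M,g,\boldsymbol{\tau})$ is a connected four-dimensional smooth manifold $M$ with a Lorentzian metric $g$ of signature $(-,+,+,+)$ and a chosen timelike vector field $\boldsymbol{\tau}$ (the time-orientation), i.e. $g_p(\boldsymbol{\tau}|_p,\boldsymbol{\tau}|_p)<0$ at every $p \in M$. A vector $v \in T_pM$ is null if $g_p(v,v)=0$; it is future directed if $g_p(v,\boldsymbol{\tau}|_p)<0$ and past directed if $g_p(v,\boldsymbol{\tau}|_p)>0$. Let $\mathcal{N}_p \subset T_pM$ be the set of null vectors at $p$ and $\mathbf{0}_p$ the zero vector of $T_pM$. The null tangent bundle is $$\mathcal{N}M = \bigsqcup_{p\in M} \mathcal{N}_p\setminus\{\mathbf{0}_p\} = \{(p,v) \mid p \in M,\ v \in \mathcal{N}_p\setminus\{\mathbf{0}_p\}\},$$ with projection $\pi(p,v)=p$. The split null cone $\mathcal{C}_0$ is the three-dimensional smooth manifold of non-zero null vectors of Minkowski space $\mathbb{R}^{1,3}$. It is the disjoint union of two components $\mathcal{C}_0^\pm$, each diffeomorphic to $\mathbb{R}^3_* := \mathbb{R}^3\setminus\{0\}$ via $\mathbb{R}^3_* \ni (x,y,z) \mapsto (\pm\sqrt{x^2+y^2+z^2},x,y,z)$,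 so $\mathcal{C}_0 \simeq \mathbb{R}^3_* \sqcup \mathbb{R}^3_*$. The charts on $\mathcal{N}M$ are the natural ones inherited from $M$: over a chart domain $U \subset M$ with coordinates $x^\mu$ and a smooth $g$-orthonormal frame (vierbein) $e_0,e_1,e_2,e_3$ with $e_0$ future directed timelike, a non-zero null vector $v_\pm = v_\pm^a e_a|_p$ (with $+$ if future directed and $-$ if past directed) is assigned the coordinates $(x^\mu, v^i_\pm)$, $i=1,2,3$, where $v_\pm^0 = \pm\sqrt{v_\pm^j v_\pm^k \delta_{kj}}$. *)

theory Defs
  imports "HOL-Analysis.Analysis"
begin

section \<open>Smooth manifolds\<close>

text \<open>For open \<open>S\<close>, \<open>C_on k S f\<close> says that \<open>f\<close> has continuous (iterated directional, equivalently
  Frechet) derivatives up to order \<open>k\<close> on \<open>S\<close>. It is only used for open \<open>S\<close>.\<close>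

primrec C_on :: "nat \<Rightarrow> 'a::real_normed_vector set \<Rightarrow> ('a \<Rightarrow> 'b::real_normed_vector) \<Rightarrow> bool" where
  "C_on 0 S f \<longleftrightarrow> continuous_on S f"
| "C_on (Suc k) S f \<longleftrightarrow>
     (\<forall>x\<in>S. f differentiable (at x)) \<and>
     (\<forall>v. C_on k S (\<lambda>x. frechet_derivative f (at x) v))"

definition smooth_on :: "'a::real_normed_vector set \<Rightarrow> ('a \<Rightarrow> 'b::real_normed_vector) \<Rightarrow> bool" where
  "smooth_on S f \<longleftrightarrow> (\<forall>k. C_on k S f)"

text \<open>A chart is a pair of its domain and its coordinate map; the values of the coordinate map
  off the domain are irrelevant. The dimension is that of the model space \<open>'e\<close>.\<close>

type_synonym ('a, 'e) chart = "'a set \<times> ('a \<Rightarrow> 'e)"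

abbreviation chart_inv :: "('a, 'e) chart \<Rightarrow> 'e \<Rightarrow> 'a" where
  "chart_inv c \<equiv> inv_into (fst c) (snd c)"

definition smooth_atlas :: "'a topology \<Rightarrow> ('a, 'e::euclidean_space) chart set \<Rightarrow> bool" where
  "smooth_atlas X A \<longleftrightarrow>
     (\<Union>c\<in>A. fst c) = topspace X \<and>
     (\<forall>(U, \<phi>)\<in>A. openin X U \<and> open (\<phi> ` U) \<and>
        homeomorphic_map (subtopology X U) (top_of_set (\<phi> ` U)) \<phi>) \<and>
     (\<forall>(U, \<phi>)\<in>A. \<forall>(V, \<psi>)\<in>A. smooth_on (\<phi> ` (U \<inter> V)) (\<psi> \<circ> inv_into U \<phi>))"

text \<open>The atlas \<open>A\<close> may, but need not, be maximal. Smoothness of maps and of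
  fibre bundles, as defined below, does not depend on its choice within a smooth structure.\<close>

definition smooth_manifold :: "'a topology \<Rightarrow> ('a, 'e::euclidean_space) chart set \<Rightarrow> bool" where
  "smooth_manifold X A \<longleftrightarrow> Hausdorff_space X \<and> second_countable X \<and> smooth_atlas X A"

definition smooth_map ::
  "'a topology \<Rightarrow> ('a, 'e::euclidean_space) chart set \<Rightarrow>
   'b topology \<Rightarrow> ('b, 'f::euclidean_space) chart set \<Rightarrow> ('a \<Rightarrow> 'b) \<Rightarrow> bool" where
  "smooth_map X A Y B f \<longleftrightarrow>
     continuous_map X Y f \<and>
     (\<forall>(U, \<phi>)\<in>A. \<forall>(V, \<psi>)\<in>B. smooth_on (\<phi> ` (U \<inter> f -` V)) (\<psi> \<circ> f \<circ> inv_into U \<phi>))"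

definition diffeomorphism ::
  "'a topology \<Rightarrow> ('a, 'e::euclidean_space) chart set \<Rightarrow>
   'b topology \<Rightarrow> ('b, 'f::euclidean_space) chart set \<Rightarrow> ('a \<Rightarrow> 'b) \<Rightarrow> bool" where
  "diffeomorphism X A Y B f \<longleftrightarrow>
     smooth_map X A Y B f \<and>
     (\<exists>h. smooth_map Y B X A h \<and>
        (\<forall>x\<in>topspace X. h (f x) = x) \<and> (\<forall>y\<in>topspace Y. f (h y) = y))"

definition diffeomorphic_manifolds ::
  "'a topology \<Rightarrow> ('a, 'e::euclidean_space) chart set \<Rightarrow>
   'b topology \<Rightarrow> ('b, 'f::euclidean_space) chart set \<Rightarrow> bool" where
  "diffeomorphic_manifolds X A Y B \<longleftrightarrow>
     smooth_manifold X A \<and> smooth_manifold Y B \<and> (\<exists>f. diffeomorphism X A Y B f)"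

definition restrict_atlas :: "('a, 'e) chart set \<Rightarrow> 'a set \<Rightarrow> ('a, 'e) chart set" where
  "restrict_atlas A W = (\<lambda>(U, \<phi>). (U \<inter> W, \<phi>)) ` A"

definition prod_atlas :: "('a, 'e) chart set \<Rightarrow> ('b, 'f) chart set \<Rightarrow> ('a \<times> 'b, 'e \<times> 'f) chart set" where
  "prod_atlas A B = {(U \<times> V, map_prod \<phi> \<psi>) | U \<phi> V \<psi>. (U, \<phi>) \<in> A \<and> (V, \<psi>) \<in> B}"

text \<open>The topology that a family of charts induces on the union of their domains.\<close>

definition atlas_topology :: "('a, 'e::euclidean_space) chart set \<Rightarrow> 'a topology" where
  "atlas_topology A = topology_generated_by {{z \<in> U. \<phi> z \<in> V} | U \<phi> V. (U, \<phi>) \<in> A \<and> open V}"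

definition smooth_fibre_bundle ::
  "'z topology \<Rightarrow> ('z, 'k::euclidean_space) chart set \<Rightarrow>
   'a topology \<Rightarrow> ('a, 'e::euclidean_space) chart set \<Rightarrow>
   'b topology \<Rightarrow> ('b, 'f::euclidean_space) chart set \<Rightarrow> ('z \<Rightarrow> 'a) \<Rightarrow> bool" where
  "smooth_fibre_bundle E AZ M A F AF pr \<longleftrightarrow>
     smooth_manifold E AZ \<and> smooth_manifold M A \<and> smooth_manifold F AF \<and>
     smooth_map E AZ M A pr \<and> pr ` topspace E = topspace M \<and>
     (\<forall>p\<in>topspace M. \<exists>W \<Phi>. openin M W \<and> p \<in> W \<and>
        diffeomorphism (subtopology E (pr -` W)) (restrict_atlas AZ (pr -` W))
          (prod_topology (subtopology M W) F) (prod_atlas (restrict_atlas A W) AF) \<Phi> \<and>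
        (\<forall>z\<in>topspace E. pr z \<in> W \<longrightarrow> fst (\<Phi> z) = pr z))"

text \<open>If the charts in \<open>AZ\<close> are adapted to \<open>pr\<close>, i.e. of the form
  (coordinates of \<open>pr z\<close>, remaining coordinates), then the remaining coordinates are slice charts
  for the fibre over \<open>p\<close> as a submanifold.\<close>

definition fibre_atlas :: "('z, 'e \<times> 'f) chart set \<Rightarrow> ('z \<Rightarrow> 'a) \<Rightarrow> 'a \<Rightarrow> ('z, 'f) chart set" where
  "fibre_atlas AZ pr p = (\<lambda>(D, \<xi>). ({z \<in> D. pr z = p}, snd \<circ> \<xi>)) ` AZ"


section \<open>Tangent vectors of four-dimensional manifolds\<close>

text \<open>A tangent vector at \<open>p\<close> is a family of components, one element of \<open>\<real>\<^sup>4\<close> for each chart around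
  \<open>p\<close>, that transforms with the Jacobian of the coordinate change. It is normalised to be \<open>0\<close> at all
  other arguments, so that the vector space operations are pointwise and the zero vector of every
  tangent space is the constant \<open>0\<close>. Components with respect to coordinates or frames, and indices
  of \<open>\<real>\<^sup>1\<^sup>,\<^sup>3\<close>, are labelled by \<open>0, 1, 2, 3 :: 4\<close>.\<close>

type_synonym 'a chart4 = "('a, real^4) chart"
type_synonym 'a tangent = "'a chart4 \<Rightarrow> real^4"

definition tangent_space :: "'a chart4 set \<Rightarrow> 'a \<Rightarrow> 'a tangent set" where
  "tangent_space A p =
     {v. (\<forall>c\<in>A. \<forall>d\<in>A. p \<in> fst c \<longrightarrow> p \<in> fst d \<longrightarrow>
            v d = frechet_derivative (snd d \<circ> chart_inv c) (at (snd c p)) (v c)) \<and>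
         (\<forall>c. \<not> (c \<in> A \<and> p \<in> fst c) \<longrightarrow> v c = 0)}"

definition zero_tangent :: "'a tangent" where
  "zero_tangent = (\<lambda>c. 0)"

definition lin_comb :: "real^4 \<Rightarrow> (4 \<Rightarrow> 'a tangent) \<Rightarrow> 'a tangent" where
  "lin_comb u e = (\<lambda>c. \<Sum>a\<in>UNIV. u $ a *\<^sub>R e a c)"

definition tangent_basis :: "'a chart4 set \<Rightarrow> 'a \<Rightarrow> (4 \<Rightarrow> 'a tangent) \<Rightarrow> bool" where
  "tangent_basis A p e \<longleftrightarrow>
     (\<forall>a. e a \<in> tangent_space A p) \<and> (\<forall>v\<in>tangent_space A p. \<exists>!u. v = lin_comb u e)"

text \<open>The coordinate vector \<open>\<partial>\<^sub>\<mu>\<close> of the chart \<open>c\<close> at \<open>p\<close>.\<close>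

definition coord_vector :: "'a chart4 set \<Rightarrow> 'a chart4 \<Rightarrow> 'a \<Rightarrow> 4 \<Rightarrow> 'a tangent" where
  "coord_vector A c p \<mu> =
     (\<lambda>d. if d \<in> A \<and> p \<in> fst d
          then frechet_derivative (snd d \<circ> chart_inv c) (at (snd c p)) (axis \<mu> 1) else 0)"

definition smooth_vector_field_on :: "'a chart4 set \<Rightarrow> 'a set \<Rightarrow> ('a \<Rightarrow> 'a tangent) \<Rightarrow> bool" where
  "smooth_vector_field_on A W X \<longleftrightarrow>
     (\<forall>p\<in>W. X p \<in> tangent_space A p) \<and>
     (\<forall>c\<in>A. smooth_on (snd c ` (fst c \<inter> W)) (\<lambda>x. X (chart_inv c x) c))"


section \<open>Spacetimes\<close>

type_synonym 'a metric_field = "'a \<Rightarrow> 'a tangent \<Rightarrow> 'a tangent \<Rightarrow> real"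

definition eta :: "4 \<Rightarrow> 4 \<Rightarrow> real" where
  "eta a b = (if a \<noteq> b then 0 else if a = 0 then -1 else 1)"

definition orthonormal_basis :: "'a chart4 set \<Rightarrow> 'a metric_field \<Rightarrow> 'a \<Rightarrow> (4 \<Rightarrow> 'a tangent) \<Rightarrow> bool" where
  "orthonormal_basis A g p e \<longleftrightarrow> tangent_basis A p e \<and> (\<forall>a b. g p (e a) (e b) = eta a b)"

definition lorentzian_metric :: "'a topology \<Rightarrow> 'a chart4 set \<Rightarrow> 'a metric_field \<Rightarrow> bool" where
  "lorentzian_metric M A g \<longleftrightarrow>
     (\<forall>p\<in>topspace M.
        (\<forall>u\<in>tangent_space A p. \<forall>v\<in>tangent_space A p. \<forall>w\<in>tangent_space A p. \<forall>r s.
           g p (\<lambda>c. r *\<^sub>R u c + s *\<^sub>R v c) w = r * g p u w + s * g p v w) \<and>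
        (\<forall>u\<in>tangent_space A p. \<forall>v\<in>tangent_space A p. g p u v = g p v u) \<and>
        (\<exists>e. orthonormal_basis A g p e)) \<and>
     (\<forall>c\<in>A. \<forall>\<mu> \<nu>. smooth_on (snd c ` fst c)
        (\<lambda>x. let p = chart_inv c x in g p (coord_vector A c p \<mu>) (coord_vector A c p \<nu>)))"

definition spacetime :: "'a topology \<Rightarrow> 'a chart4 set \<Rightarrow> 'a metric_field \<Rightarrow> ('a \<Rightarrow> 'a tangent) \<Rightarrow> bool" where
  "spacetime M A g \<tau> \<longleftrightarrow>
     smooth_manifold M A \<and> connected_space M \<and> lorentzian_metric M A g \<and>
     smooth_vector_field_on A (topspace M) \<tau> \<and> (\<forall>p\<in>topspace M. g p (\<tau> p) (\<tau> p) < 0)"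

definition null_vectors :: "'a chart4 set \<Rightarrow> 'a metric_field \<Rightarrow> 'a \<Rightarrow> 'a tangent set" where
  "null_vectors A g p = {v \<in> tangent_space A p. g p v v = 0}"


section \<open>The null tangent bundle\<close>

definition null_bundle :: "'a topology \<Rightarrow> 'a chart4 set \<Rightarrow> 'a metric_field \<Rightarrow> ('a \<times> 'a tangent) set" where
  "null_bundle M A g = (SIGMA p : topspace M. null_vectors A g p - {zero_tangent})"

definition vierbein_on ::
  "'a chart4 set \<Rightarrow> 'a metric_field \<Rightarrow> ('a \<Rightarrow> 'a tangent) \<Rightarrow> 'a set \<Rightarrow> (4 \<Rightarrow> 'a \<Rightarrow> 'a tangent) \<Rightarrow> bool" where
  "vierbein_on A g \<tau> W e \<longleftrightarrow>
     (\<forall>a. smooth_vector_field_on A W (e a)) \<and>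
     (\<forall>p\<in>W. orthonormal_basis A g p (\<lambda>a. e a p) \<and> g p (e 0 p) (\<tau> p) < 0)"

definition frame_components :: "(4 \<Rightarrow> 'a \<Rightarrow> 'a tangent) \<Rightarrow> 'a \<Rightarrow> 'a tangent \<Rightarrow> real^4" where
  "frame_components e p v = (THE u. v = lin_comb u (\<lambda>a. e a p))"

definition spatial :: "real^4 \<Rightarrow> real^3" where
  "spatial u = vector [u $ 1, u $ 2, u $ 3]"

text \<open>The sign \<open>\<sigma> = 1\<close> selects the future directed and \<open>\<sigma> = -1\<close> the past directed null vectors.
  A vierbein need not exist over the whole domain of a given chart in \<open>A\<close>, hence the passage to the
  restricted coordinate domain \<open>W\<close> (for a maximal atlas, \<open>(W, \<phi>)\<close> is itself a chart).\<close>

definition null_chart ::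
  "'a topology \<Rightarrow> 'a chart4 set \<Rightarrow> 'a metric_field \<Rightarrow> ('a \<Rightarrow> 'a tangent) \<Rightarrow>
   real \<Rightarrow> 'a set \<Rightarrow> ('a \<Rightarrow> real^4) \<Rightarrow> (4 \<Rightarrow> 'a \<Rightarrow> 'a tangent) \<Rightarrow>
   ('a \<times> 'a tangent, (real^4) \<times> (real^3)) chart" where
  "null_chart M A g \<tau> \<sigma> W \<phi> e =
     ({(p, v) \<in> null_bundle M A g. p \<in> W \<and> \<sigma> * g p v (\<tau> p) < 0},
      \<lambda>(p, v). (\<phi> p, spatial (frame_components e p v)))"

definition null_atlas ::
  "'a topology \<Rightarrow> 'a chart4 set \<Rightarrow> 'a metric_field \<Rightarrow> ('a \<Rightarrow> 'a tangent) \<Rightarrow>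
   ('a \<times> 'a tangent, (real^4) \<times> (real^3)) chart set" where
  "null_atlas M A g \<tau> =
     {null_chart M A g \<tau> \<sigma> W \<phi> e | \<sigma> U W \<phi> e.
        \<sigma> \<in> {1, -1} \<and> (U, \<phi>) \<in> A \<and> openin M W \<and> W \<subseteq> U \<and> vierbein_on A g \<tau> W e}"

definition null_bundle_topology ::
  "'a topology \<Rightarrow> 'a chart4 set \<Rightarrow> 'a metric_field \<Rightarrow> ('a \<Rightarrow> 'a tangent) \<Rightarrow> ('a \<times> 'a tangent) topology" where
  "null_bundle_topology M A g \<tau> = atlas_topology (null_atlas M A g \<tau>)"


section \<open>The split null cone\<close>

definition split_null_cone :: "(real^4) set" where
  "split_null_cone = {u. u \<noteq> 0 \<and> (\<Sum>a\<in>UNIV. \<Sum>b\<in>UNIV. eta a b * u $ a * u $ b) = 0}"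

definition cone_param :: "real \<Rightarrow> real^3 \<Rightarrow> real^4" where
  "cone_param \<sigma> x =
     (\<chi> a. if a = 0 then \<sigma> * norm x else if a = 1 then x $ 1 else if a = 2 then x $ 2 else x $ 3)"

definition null_cone_plus :: "(real^4) set" where
  "null_cone_plus = cone_param 1 ` (- {0})"

definition null_cone_minus :: "(real^4) set" where
  "null_cone_minus = cone_param (-1) ` (- {0})"

text \<open>On each component \<open>spatial\<close> is the inverse of the parametrisation \<open>cone_param\<close>.\<close>

definition cone_atlas :: "(real^4, real^3) chart set" where
  "cone_atlas = {(null_cone_plus, spatial), (null_cone_minus, spatial)}"

end

theory Submission
  imports Defs
begin

text \<open>A vierbein \<open>e\<close> over an open set \<open>W\<close> turns the metric at each point of \<open>W\<close> into the Minkowski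
  product, so passing to frame components maps the nonzero null vectors at \<open>p\<close> bijectively onto the
  split null cone. Future and past directed vectors go to the two components of the cone, because
  a null and a timelike vector have a product of definite sign
  (\<open>minkowski_null_timelike_sign\<close>). Each component is parametrised by \<open>\<real>\<^sup>3 - {0}\<close>, where the norm is
  smooth. The bundle is therefore modelled on the cone as soon as vierbeins exist near every point
  and transitions between null charts are smooth.

  Vierbeins come from the Gram--Schmidt process (\<open>local_gram_schmidt\<close>, \<open>exists_local_vierbein\<close>),
  started at an orthonormal basis of one tangent space. In a transition the new frame components
  of a vector are, up to sign, its products with the new frame, hence linear in the old components
  with coefficients that are smooth on the base (\<open>null_atlas_smooth_transition\<close>). By the smooth
  manifold chart lemma (\<open>smooth_atlas_atlas_topology\<close>) the null charts are then a smooth atlas for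
  the topology that they generate. This topology is Hausdorff, and second countable because
  countably many vierbein domains cover the base.

  The map \<open>(p, v) \<mapsto> (p, components of v)\<close> pulls the product charts of \<open>W \<times> split_null_cone\<close> back to
  null charts, and on one fibre it pulls the charts of the cone back to the slice charts. A
  bijection with this property is a diffeomorphism (\<open>diffeomorphism_pullback_charts\<close>), which gives
  both the local triviality and the type of the fibres.\<close>


section \<open>Calculus of smooth maps\<close>

lemma C_on_cong:
  assumes "open S" "\<And>x. x \<in> S \<Longrightarrow> f x = g x" "C_on k S f"
  shows "C_on k S g"
  using assms(2,3)
proof (induction k arbitrary: f g)
  case 0
  then show ?case using continuous_on_cong[of S S f g] by simp
next
  case (Suc k)
  have D: "frechet_derivative f (at x) = frechet_derivative g (at x)" if "x \<in> S" for x
    using Suc.prems that assms(1) by (intro frechet_derivative_transform_within_open) auto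
  have "g differentiable (at x)" if "x \<in> S" for x
  proof -
    have "f differentiable (at x)"
      using Suc.prems(2) that by simp
    then show ?thesis
      using that assms(1) Suc.prems(1) unfolding differentiable_def
      by (meson has_derivative_transform_within_open)
  qed
  moreover have "C_on k S (\<lambda>x. frechet_derivative g (at x) v)" for v
    using Suc.IH[of "\<lambda>x. frechet_derivative f (at x) v"] D Suc.prems(2) by simp
  ultimately show ?case by simp
qed

lemma C_on_SucI:
  assumes "open S" "\<And>x. x \<in> S \<Longrightarrow> (f has_derivative D x) (at x)"
    "\<And>v. C_on k S (\<lambda>x. D x v)"
  shows "C_on (Suc k) S f"
proof -
  have D: "frechet_derivative f (at x) = D x" if "x \<in> S" for x
    using assms(2)[OF that] frechet_derivative_at by metis
  have "C_on k S (\<lambda>x. frechet_derivative f (at x) v)" for v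
    by (rule C_on_cong[OF assms(1) _ assms(3)]) (simp add: D)
  then show ?thesis
    using assms(2) by (auto simp: differentiable_def)
qed

lemma C_on_SucD: "C_on (Suc k) S f \<Longrightarrow> C_on k S f"
proof (induction k arbitrary: f)
  case 0
  then show ?case
    by (auto intro!: continuous_at_imp_continuous_on differentiable_imp_continuous_within)
next
  case (Suc k)
  then show ?case by (meson C_on.simps(2))
qed

lemma C_on_has_derivative:
  "C_on (Suc k) S f \<Longrightarrow> x \<in> S \<Longrightarrow> (f has_derivative frechet_derivative f (at x)) (at x)"
  by (simp add: frechet_derivative_works)

lemma C_on_subset:
  "C_on k S f \<Longrightarrow> T \<subseteq> S \<Longrightarrow> C_on k T f"
proof (induction k arbitrary: f)
  case 0 then show ?case using continuous_on_subset by auto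
next
  case (Suc k) then show ?case by auto
qed

lemma C_on_const: "open S \<Longrightarrow> C_on k S (\<lambda>x. c)"
proof (induction k arbitrary: c)
  case (Suc k)
  then show ?case by (intro C_on_SucI[where D="\<lambda>x v. 0"]) auto
qed simp

lemma C_on_linear:
  assumes "open S" "bounded_linear h" "C_on k S f"
  shows "C_on k S (\<lambda>x. h (f x))"
  using assms(3)
proof (induction k arbitrary: f)
  case 0
  then show ?case
    using assms(2) by (simp add: bounded_linear.continuous_on)
next
  case (Suc k)
  show ?case
    by (rule C_on_SucI[OF assms(1), where D="\<lambda>x v. h (frechet_derivative f (at x) v)"])
      (use Suc in \<open>auto intro!: bounded_linear.has_derivative[OF assms(2)] C_on_has_derivative[of k S]\<close>)
qed

lemma C_on_ident: "open S \<Longrightarrow> C_on k S (\<lambda>x. x)"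
proof (cases k)
  case (Suc k')
  assume "open S"
  then show ?thesis unfolding Suc
    by (intro C_on_SucI[where D="\<lambda>x v. v"]) (auto intro: C_on_const)
qed simp

lemma C_on_add:
  assumes "open S" "C_on k S f" "C_on k S g"
  shows "C_on k S (\<lambda>x. f x + g x)"
  using assms(2,3)
proof (induction k arbitrary: f g)
  case 0
  then show ?case by (simp add: continuous_on_add)
next
  case (Suc k)
  show ?case
    by (rule C_on_SucI[OF assms(1),
          where D="\<lambda>x v. frechet_derivative f (at x) v + frechet_derivative g (at x) v"])
      (use Suc in \<open>auto intro!: has_derivative_add C_on_has_derivative[of k S]\<close>)
qed

lemma C_on_sum:
  assumes "open S" "\<And>i. i \<in> I \<Longrightarrow> C_on k S (f i)"
  shows "C_on k S (\<lambda>x. \<Sum>i\<in>I. f i x)"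
  using assms(2)
proof (induction I rule: infinite_finite_induct)
  case (insert i I)
  then show ?case using C_on_add[OF assms(1), of k "f i" "\<lambda>x. \<Sum>i\<in>I. f i x"] by simp
qed (auto intro: C_on_const assms)

lemma C_on_bilinear:
  assumes "open S" "bounded_bilinear B" "C_on k S f" "C_on k S g"
  shows "C_on k S (\<lambda>x. B (f x) (g x))"
  using assms(3,4)
proof (induction k arbitrary: f g)
  case 0
  then show ?case
    using assms(2) by (simp add: bounded_bilinear.continuous_on)
next
  case (Suc k)
  have "C_on k S (\<lambda>x. B (f x) (frechet_derivative g (at x) v) + B (frechet_derivative f (at x) v) (g x))" for v
    using Suc C_on_SucD[OF Suc.prems(1)] C_on_SucD[OF Suc.prems(2)]
    by (intro C_on_add[OF assms(1)]) auto
  then show ?case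
    by (intro C_on_SucI[OF assms(1),
       where D="\<lambda>x v. B (f x) (frechet_derivative g (at x) v) + B (frechet_derivative f (at x) v) (g x)"])
      (use Suc in \<open>auto intro!: bounded_bilinear.FDERIV[OF assms(2)] C_on_has_derivative[of k S]\<close>)
qed

lemma linear_eq_sum_Basis:
  fixes h :: "'b::euclidean_space \<Rightarrow> 'c::real_vector"
  assumes "linear h"
  shows "(\<Sum>b\<in>Basis. (v \<bullet> b) *\<^sub>R h b) = h v"
proof -
  have "h v = h (\<Sum>b\<in>Basis. (v \<bullet> b) *\<^sub>R b)"
    by (simp only: euclidean_representation)
  also have "\<dots> = (\<Sum>b\<in>Basis. (v \<bullet> b) *\<^sub>R h b)"
    by (simp add: linear_sum[OF assms] linear_scale[OF assms])
  finally show ?thesis by simp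
qed

text \<open>By the chain rule the derivative of \<open>g \<circ> f\<close> in a fixed direction \<open>v\<close> is the derivative of
  \<open>g\<close> in the direction \<open>f' x v\<close>, which varies with \<open>x\<close>. Expanded in a basis it is a sum of
  products of lower order, to which the induction hypothesis applies.\<close>

lemma C_on_compose:
  fixes f :: "'a::real_normed_vector \<Rightarrow> 'b::euclidean_space" and g :: "'b \<Rightarrow> 'c::real_normed_vector"
  assumes "open S" "open T" "f ` S \<subseteq> T" "C_on k S f" "C_on k T g"
  shows "C_on k S (\<lambda>x. g (f x))"
  using assms(4,5)
proof (induction k arbitrary: g)
  case 0
  then show ?case using assms(3) by (auto intro: continuous_on_compose2)
next
  case (Suc k)
  define f' where "f' x = frechet_derivative f (at x)" for x
  define g' where "g' x = frechet_derivative g (at x)" for x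
  have f': "(f has_derivative f' x) (at x)" if "x \<in> S" for x
    using C_on_has_derivative[OF Suc.prems(1) that] by (simp add: f'_def)
  have g': "(g has_derivative g' (f x)) (at (f x))" if "x \<in> S" for x
    using C_on_has_derivative[OF Suc.prems(2)] that assms(3) by (auto simp: g'_def)
  have "C_on k S (\<lambda>x. \<Sum>b\<in>Basis. (f' x v \<bullet> b) *\<^sub>R g' (f x) b)" for v
  proof (intro C_on_sum C_on_bilinear[OF _ bounded_bilinear_scaleR] assms(1))
    fix b :: 'b assume "b \<in> Basis"
    show "C_on k S (\<lambda>x. f' x v \<bullet> b)"
      using Suc.prems(1) by (intro C_on_linear[OF assms(1) bounded_linear_inner_left]) (simp add: f'_def)
    show "C_on k S (\<lambda>x. g' (f x) b)"
      using Suc.prems C_on_SucD by (intro Suc.IH) (auto simp: g'_def)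
  qed
  moreover have "(\<Sum>b\<in>Basis. (f' x v \<bullet> b) *\<^sub>R g' (f x) b) = g' (f x) (f' x v)" if "x \<in> S" for x v
  proof -
    have "linear (g' (f x))"
      using g'[OF that] has_derivative_linear by blast
    then show ?thesis
      by (rule linear_eq_sum_Basis)
  qed
  ultimately have "C_on k S (\<lambda>x. g' (f x) (f' x v))" for v
    by (rule C_on_cong[OF assms(1), rotated]) auto
  moreover have "((\<lambda>x. g (f x)) has_derivative (\<lambda>v. g' (f x) (f' x v))) (at x)" if "x \<in> S" for x
    using has_derivative_compose[OF f' g'] that by blast
  ultimately show ?case
    by (intro C_on_SucI[OF assms(1)])
qed

text \<open>Powers supply both the square root in the norm of \<open>\<real>\<^sup>3\<close> and the reciprocal square root that
  normalises a vector field. The exponent is arbitrary in the induction because differentiation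
  lowers it.\<close>

lemma C_on_powr: "C_on k {0<..} (\<lambda>x::real. x powr a)"
proof (induction k arbitrary: a)
  case 0
  show ?case by (simp add: continuous_on_powr continuous_on_id continuous_on_const less_imp_neq[symmetric])
next
  case (Suc k)
  show ?case
  proof (rule C_on_SucI[where D="\<lambda>x v. v * (a * x powr (a - 1))"])
    show "((\<lambda>x. x powr a) has_derivative (\<lambda>v. v * (a * x powr (a - 1)))) (at x)" if "x \<in> {0<..}" for x
    proof -
      have "(*) (a * x powr (a - 1)) = (\<lambda>v. v * (a * x powr (a - 1)))"
        by (rule ext) (rule mult.commute)
      then show ?thesis
        using has_real_derivative_powr[of x a] that by (simp only: has_field_derivative_def greaterThan_iff)
    qed
    show "C_on k {0<..} (\<lambda>x. v * (a * x powr (a - 1)))" for v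
      using C_on_linear[OF _ bounded_linear_mult_right Suc, of "v * a"] by (simp add: mult.assoc)
  qed auto
qed

lemma smooth_on_cong:
  "open S \<Longrightarrow> (\<And>x. x \<in> S \<Longrightarrow> f x = g x) \<Longrightarrow> smooth_on S f \<Longrightarrow> smooth_on S g"
  unfolding smooth_on_def by (intro allI, rule C_on_cong[of S f]) auto

lemma smooth_on_subset: "smooth_on S f \<Longrightarrow> T \<subseteq> S \<Longrightarrow> smooth_on T f"
  unfolding smooth_on_def by (intro allI, rule C_on_subset[of _ S]) auto

lemma smooth_on_imp_continuous_on: "smooth_on S f \<Longrightarrow> continuous_on S f"
  unfolding smooth_on_def by (drule spec[of _ 0]) simp

lemma smooth_on_has_derivative:
  "smooth_on S f \<Longrightarrow> x \<in> S \<Longrightarrow> (f has_derivative frechet_derivative f (at x)) (at x)"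
  unfolding smooth_on_def by (rule C_on_has_derivative[of 0]) auto

lemma smooth_on_const: "open S \<Longrightarrow> smooth_on S (\<lambda>x. c)"
  by (simp add: smooth_on_def C_on_const)

lemma smooth_on_ident: "open S \<Longrightarrow> smooth_on S (\<lambda>x. x)"
  by (simp add: smooth_on_def C_on_ident)

lemma smooth_on_linear: "open S \<Longrightarrow> bounded_linear h \<Longrightarrow> smooth_on S f \<Longrightarrow> smooth_on S (\<lambda>x. h (f x))"
  by (simp add: smooth_on_def C_on_linear)

lemma smooth_on_add:
  "open S \<Longrightarrow> smooth_on S f \<Longrightarrow> smooth_on S g \<Longrightarrow> smooth_on S (\<lambda>x. f x + g x)"
  by (simp add: smooth_on_def C_on_add)

lemma smooth_on_diff:
  "open S \<Longrightarrow> smooth_on S f \<Longrightarrow> smooth_on S g \<Longrightarrow> smooth_on S (\<lambda>x. f x - g x)"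
  using smooth_on_add[of S f "\<lambda>x. - g x"]
    smooth_on_linear[OF _ bounded_linear_minus[OF bounded_linear_ident], of S g] by simp

lemma smooth_on_sum:
  "open S \<Longrightarrow> (\<And>i. i \<in> I \<Longrightarrow> smooth_on S (f i)) \<Longrightarrow> smooth_on S (\<lambda>x. \<Sum>i\<in>I. f i x)"
  by (simp add: smooth_on_def C_on_sum)

lemma smooth_on_bilinear:
  "open S \<Longrightarrow> bounded_bilinear B \<Longrightarrow> smooth_on S f \<Longrightarrow> smooth_on S g \<Longrightarrow> smooth_on S (\<lambda>x. B (f x) (g x))"
  by (simp add: smooth_on_def C_on_bilinear)

lemmas smooth_on_scaleR = smooth_on_bilinear[OF _ bounded_bilinear_scaleR]
lemmas smooth_on_inner = smooth_on_bilinear[OF _ bounded_bilinear_inner]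

lemma smooth_on_mult:
  fixes f g :: "'a::real_normed_vector \<Rightarrow> real"
  shows "open S \<Longrightarrow> smooth_on S f \<Longrightarrow> smooth_on S g \<Longrightarrow> smooth_on S (\<lambda>x. f x * g x)"
  by (rule smooth_on_bilinear[OF _ bounded_bilinear_mult])

lemma smooth_on_compose:
  fixes f :: "'a::real_normed_vector \<Rightarrow> 'b::euclidean_space" and g :: "'b \<Rightarrow> 'c::real_normed_vector"
  shows "smooth_on T g \<Longrightarrow> smooth_on S f \<Longrightarrow> f ` S \<subseteq> T \<Longrightarrow> open S \<Longrightarrow> open T \<Longrightarrow>
    smooth_on S (\<lambda>x. g (f x))"
  unfolding smooth_on_def by (intro allI, rule C_on_compose[of S T]) auto

lemma smooth_on_powr:
  fixes f :: "'a::real_normed_vector \<Rightarrow> real"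
  assumes "open S" "smooth_on S f" "\<And>x. x \<in> S \<Longrightarrow> f x > 0"
  shows "smooth_on S (\<lambda>x. f x powr a)"
  by (rule smooth_on_compose[of "{0<..}" "\<lambda>y. y powr a" S f])
    (use assms C_on_powr in \<open>auto simp: smooth_on_def\<close>)

lemma smooth_on_norm:
  fixes f :: "'a::real_normed_vector \<Rightarrow> 'b::real_inner"
  assumes "open S" "smooth_on S f" "\<And>x. x \<in> S \<Longrightarrow> f x \<noteq> 0"
  shows "smooth_on S (\<lambda>x. norm (f x))"
proof -
  have "smooth_on S (\<lambda>x. (f x \<bullet> f x) powr (1/2))"
    using assms by (intro smooth_on_powr smooth_on_inner) auto
  then show ?thesis
    by (simp add: norm_eq_sqrt_inner powr_half_sqrt)
qed

lemma smooth_on_Pair: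
  assumes "open S" "smooth_on S f" "smooth_on S g"
  shows "smooth_on S (\<lambda>x. (f x, g x))"
proof -
  have "smooth_on S (\<lambda>x. (f x, 0) + (0, g x))"
    using assms by (intro smooth_on_add smooth_on_linear[where h="\<lambda>y. (y, 0)"] smooth_on_linear[where h="\<lambda>y. (0, y)"]
        bounded_linear_Pair bounded_linear_ident bounded_linear_zero)
  then show ?thesis by simp
qed

lemma smooth_on_nth:
  fixes f :: "'a::real_normed_vector \<Rightarrow> real^'n"
  shows "open S \<Longrightarrow> smooth_on S f \<Longrightarrow> smooth_on S (\<lambda>x. f x $ i)"
  by (rule smooth_on_linear[OF _ bounded_linear_vec_nth])

lemma smooth_on_vecI:
  fixes f :: "'a::real_normed_vector \<Rightarrow> real^'n"
  assumes "open S" "\<And>i. smooth_on S (\<lambda>x. f x $ i)"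
  shows "smooth_on S f"
proof -
  have "smooth_on S (\<lambda>x. \<Sum>i\<in>UNIV. f x $ i *\<^sub>R axis i (1::real))"
    using assms by (intro smooth_on_sum smooth_on_scaleR smooth_on_const)
  then show ?thesis
    using basis_expansion[of "f x" for x] by (simp add: scalar_mult_eq_scaleR)
qed

text \<open>\<open>C_on\<close> only speaks of derivatives in a fixed direction; expanding the direction in a basis
  gives smoothness along a smoothly varying one. This is what the transformation law of tangent
  vectors requires.\<close>

lemma smooth_on_frechet_derivative:
  fixes f :: "'a::euclidean_space \<Rightarrow> 'b::real_normed_vector"
  assumes "open S" "smooth_on S f" "smooth_on S h"
  shows "smooth_on S (\<lambda>x. frechet_derivative f (at x) (h x))"
proof -
  have "smooth_on S (\<lambda>x. \<Sum>b\<in>Basis. (h x \<bullet> b) *\<^sub>R frechet_derivative f (at x) b)"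
  proof (intro smooth_on_sum smooth_on_scaleR smooth_on_inner smooth_on_const assms)
    show "smooth_on S (\<lambda>x. frechet_derivative f (at x) b)" for b
      unfolding smooth_on_def
    proof
      fix k
      have "C_on (Suc k) S f"
        using assms(2) by (simp only: smooth_on_def)
      then show "C_on k S (\<lambda>x. frechet_derivative f (at x) b)" by simp
    qed
  qed
  moreover have "(\<Sum>b\<in>Basis. (h x \<bullet> b) *\<^sub>R frechet_derivative f (at x) b)
      = frechet_derivative f (at x) (h x)" if "x \<in> S" for x
  proof -
    have "linear (frechet_derivative f (at x))"
      using smooth_on_has_derivative[OF assms(2) that] has_derivative_linear by blast
    then show ?thesis
      by (rule linear_eq_sum_Basis)
  qed
  ultimately show ?thesis
    by (rule smooth_on_cong[OF assms(1), rotated]) auto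
qed


section \<open>Charts and atlases\<close>

definition topological_chart :: "'a topology \<Rightarrow> ('a, 'e::euclidean_space) chart \<Rightarrow> bool" where
  "topological_chart X c \<longleftrightarrow> openin X (fst c) \<and> open (snd c ` fst c) \<and>
     homeomorphic_map (subtopology X (fst c)) (top_of_set (snd c ` fst c)) (snd c)"

text \<open>Being a homeomorphism onto an open set amounts to injectivity with open preimages and open
  images, conditions in which no subspace topology occurs. Restrictions, products and slices of
  charts are checked in this form.\<close>

lemma topological_chart_iff:
  "topological_chart X c \<longleftrightarrow> openin X (fst c) \<and> inj_on (snd c) (fst c) \<and>
     (\<forall>V. open V \<longrightarrow> openin X {z \<in> fst c. snd c z \<in> V}) \<and>
     (\<forall>T. openin X T \<longrightarrow> open (snd c ` (fst c \<inter> T)))"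
proof (cases c)
  case (Pair U \<phi>)
  have "topological_chart X (U, \<phi>) \<longleftrightarrow> openin X U \<and> inj_on \<phi> U \<and>
     (\<forall>V. open V \<longrightarrow> openin X {z \<in> U. \<phi> z \<in> V}) \<and> (\<forall>T. openin X T \<longrightarrow> open (\<phi> ` (U \<inter> T)))"
    (is "?L \<longleftrightarrow> ?R")
  proof
    assume L: ?L
    then have U: "openin X U" and o: "open (\<phi> ` U)"
      and h: "homeomorphic_map (subtopology X U) (top_of_set (\<phi> ` U)) \<phi>"
      by (auto simp: topological_chart_def)
    have ts: "topspace (subtopology X U) = U"
      using openin_subset[OF U] by (simp add: inf_absorb2)
    have "openin X {z \<in> U. \<phi> z \<in> V}" if "open V" for V
    proof -
      have "openin (subtopology X U) {z \<in> topspace (subtopology X U). \<phi> z \<in> \<phi> ` U \<inter> V}"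
        using homeomorphic_imp_continuous_map[OF h] that
        by (intro openin_continuous_map_preimage) (auto simp: openin_open)
      moreover have "{z \<in> topspace (subtopology X U). \<phi> z \<in> \<phi> ` U \<inter> V} = {z \<in> U. \<phi> z \<in> V}"
        unfolding ts by auto
      ultimately show ?thesis
        using U by (simp add: openin_open_subtopology)
    qed
    moreover have "open (\<phi> ` (U \<inter> T))" if "openin X T" for T
    proof -
      have "openin (subtopology X U) (U \<inter> T)"
        using that by (simp add: openin_subtopology_Int2)
      then have "openin (top_of_set (\<phi> ` U)) (\<phi> ` (U \<inter> T))"
        using homeomorphic_imp_open_map[OF h] by (simp add: open_map_def)
      then show ?thesis
        using o openin_open_eq by blast
    qed
    ultimately show ?R
      using U homeomorphic_imp_injective_map[OF h] ts by auto
  next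
    assume R: ?R
    then have U: "openin X U" by blast
    have ts: "topspace (subtopology X U) = U"
      using openin_subset[OF U] by (simp add: inf_absorb2)
    have o: "open (\<phi> ` U)"
      using R U by (metis inf.idem)
    have "homeomorphic_map (subtopology X U) (top_of_set (\<phi> ` U)) \<phi>"
    proof (rule bijective_open_imp_homeomorphic_map)
      show "continuous_map (subtopology X U) (top_of_set (\<phi> ` U)) \<phi>"
        unfolding continuous_map_def ts
      proof (intro conjI allI impI)
        fix V assume "openin (top_of_set (\<phi> ` U)) V"
        then have "open V" using o openin_open_eq by blast
        then show "openin (subtopology X U) {x \<in> U. \<phi> x \<in> V}"
          using R U by (auto simp: openin_open_subtopology)
      qed auto
      show "open_map (subtopology X U) (top_of_set (\<phi> ` U)) \<phi>"
        unfolding open_map_def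
      proof (intro allI impI)
        fix T assume "openin (subtopology X U) T"
        then have "openin X T" "T \<subseteq> U" using U by (auto simp: openin_open_subtopology)
        then have "open (\<phi> ` T)" using R by (metis inf.absorb2)
        then show "openin (top_of_set (\<phi> ` U)) (\<phi> ` T)"
          using o \<open>T \<subseteq> U\<close> by (auto simp: openin_open_eq)
      qed
    qed (use R in \<open>auto simp only: ts topspace_euclidean_subtopology\<close>)
    then show ?L
      using U o by (simp add: topological_chart_def)
  qed
  then show ?thesis by (simp add: Pair)
qed

lemma
  assumes "topological_chart X c"
  shows chart_domain: "openin X (fst c)" and chart_inj: "inj_on (snd c) (fst c)"
    and chart_preimage: "open V \<Longrightarrow> openin X {z \<in> fst c. snd c z \<in> V}"
    and chart_image: "openin X T \<Longrightarrow> open (snd c ` (fst c \<inter> T))"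
  using assms by (auto simp: topological_chart_iff)

lemma chart_domain_subset: "topological_chart X c \<Longrightarrow> fst c \<subseteq> topspace X"
  using chart_domain openin_subset by blast

lemma chart_inv_eq: "topological_chart X c \<Longrightarrow> z \<in> fst c \<Longrightarrow> chart_inv c (snd c z) = z"
  by (simp add: chart_inj)

lemma smooth_atlas_iff:
  "smooth_atlas X A \<longleftrightarrow> \<Union>(fst ` A) = topspace X \<and> (\<forall>c\<in>A. topological_chart X c) \<and>
     (\<forall>c\<in>A. \<forall>d\<in>A. smooth_on (snd c ` (fst c \<inter> fst d)) (snd d \<circ> chart_inv c))"
  unfolding smooth_atlas_def topological_chart_def by (simp add: case_prod_beta)

lemma
  assumes "smooth_atlas X A"
  shows atlas_cover: "\<Union>(fst ` A) = topspace X"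
    and atlas_chart: "c \<in> A \<Longrightarrow> topological_chart X c"
    and atlas_smooth: "c \<in> A \<Longrightarrow> d \<in> A \<Longrightarrow> smooth_on (snd c ` (fst c \<inter> fst d)) (snd d \<circ> chart_inv c)"
  using assms by (auto simp: smooth_atlas_iff)

text \<open>The smooth manifold chart lemma: injective coordinate maps with open overlaps and smooth
  transitions are homeomorphisms for the topology that they generate. The content is that images
  of open sets are open, which propagates from the generating sets because there it is the
  continuity of a transition.\<close>

lemma smooth_atlas_atlas_topology:
  fixes A :: "('a, 'e::euclidean_space) chart set"
  assumes inj: "\<And>c. c \<in> A \<Longrightarrow> inj_on (snd c) (fst c)"
    and op: "\<And>c d. c \<in> A \<Longrightarrow> d \<in> A \<Longrightarrow> open (snd c ` (fst c \<inter> fst d))"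
    and sm: "\<And>c d. c \<in> A \<Longrightarrow> d \<in> A \<Longrightarrow> smooth_on (snd c ` (fst c \<inter> fst d)) (snd d \<circ> chart_inv c)"
  shows "topspace (atlas_topology A) = \<Union>(fst ` A)" and "smooth_atlas (atlas_topology A) A"
proof -
  define G where "G = {{z \<in> U. \<phi> z \<in> V} | U \<phi> V. (U, \<phi>) \<in> A \<and> open (V::'e set)}"
  have top: "atlas_topology A = topology_generated_by G"
    by (simp add: atlas_topology_def G_def)
  have inG: "{z \<in> fst c. snd c z \<in> V} \<in> G" if "c \<in> A" "open V" for c V
    unfolding G_def using that by (intro CollectI exI[of _ "fst c"] exI[of _ "snd c"]) auto
  show ts: "topspace (atlas_topology A) = \<Union>(fst ` A)"
  proof
    show "topspace (atlas_topology A) \<subseteq> \<Union>(fst ` A)"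
      unfolding top topology_generated_by_topspace by (force simp: G_def)
    show "\<Union>(fst ` A) \<subseteq> topspace (atlas_topology A)"
      unfolding top topology_generated_by_topspace using inG[of _ UNIV] by auto
  qed
  have "topological_chart (atlas_topology A) c" if c: "c \<in> A" for c
    unfolding topological_chart_iff
  proof (intro conjI allI impI)
    show pre: "openin (atlas_topology A) {z \<in> fst c. snd c z \<in> V}" if "open V" for V
      unfolding top using inG[OF c that] by (rule topology_generated_by_Basis)
    show "openin (atlas_topology A) (fst c)"
      using pre[of UNIV] by simp
    show "inj_on (snd c) (fst c)"
      by (rule inj[OF c])
    fix T assume "openin (atlas_topology A) T"
    then have "generate_topology_on G T"
      by (simp add: top openin_topology_generated_by)
    then show "open (snd c ` (fst c \<inter> T))"
    proof induction
      case (Int a b)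
      have "snd c ` (fst c \<inter> (a \<inter> b)) = snd c ` (fst c \<inter> a) \<inter> snd c ` (fst c \<inter> b)"
        using inj_on_image_Int[OF inj[OF c], of "fst c \<inter> a" "fst c \<inter> b"]
        by (simp add: inf_assoc inf_left_commute)
      then show ?case using Int by auto
    next
      case (UN K)
      have "snd c ` (fst c \<inter> \<Union>K) = (\<Union>k\<in>K. snd c ` (fst c \<inter> k))" by auto
      then show ?case using UN by auto
    next
      case (Basis s)
      then obtain d V where d: "d \<in> A" "open V" "s = {z \<in> fst d. snd d z \<in> V}"
        unfolding G_def by auto
      have "snd c ` (fst c \<inter> s) = (snd d \<circ> chart_inv c) -` V \<inter> snd c ` (fst c \<inter> fst d)"
        using inj[OF c] by (auto simp: d(3))
      then show ?case
        using continuous_open_preimage[OF smooth_on_imp_continuous_on[OF sm[OF c d(1)]] op[OF c d(1)] d(2)]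
        by (simp add: inf_commute)
    qed auto
  qed
  then show "smooth_atlas (atlas_topology A) A"
    unfolding smooth_atlas_iff using ts sm by auto
qed

text \<open>The preimages of a countable base of the model space under countably many charts form a
  countable base.\<close>

lemma second_countable_countable_charts:
  fixes B :: "('a, 'e::euclidean_space) chart set"
  assumes "countable B" "\<And>c. c \<in> B \<Longrightarrow> topological_chart X c" "topspace X \<subseteq> \<Union>(fst ` B)"
  shows "second_countable X"
proof -
  obtain K :: "'e set set" where K: "countable K" "topological_basis K"
    using ex_countable_basis by blast
  define \<B> where "\<B> = (\<Union>c\<in>B. (\<lambda>Q. {z \<in> fst c. snd c z \<in> Q}) ` K)"
  have "countable \<B>"
    unfolding \<B>_def by (intro countable_UN countable_image assms(1) K(1))
  moreover have "openin X V" if V: "V \<in> \<B>" for V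
  proof -
    obtain c Q where "c \<in> B" "Q \<in> K" "V = {z \<in> fst c. snd c z \<in> Q}"
      using V unfolding \<B>_def by (elim UN_E imageE)
    then show ?thesis
      using chart_preimage[OF assms(2), of c Q] topological_basis_open[OF K(2), of Q] by simp
  qed
  moreover have "\<exists>V\<in>\<B>. x \<in> V \<and> V \<subseteq> T" if T: "openin X T" "x \<in> T" for T x
  proof -
    have "x \<in> \<Union>(fst ` B)"
      using assms(3) openin_subset[OF T(1)] T(2) by blast
    then obtain c where c: "c \<in> B" "x \<in> fst c" by blast
    note ch = assms(2)[OF c(1)]
    have "open (snd c ` (fst c \<inter> T))" "snd c x \<in> snd c ` (fst c \<inter> T)"
      using chart_image[OF ch T(1)] T(2) c(2) by auto
    then obtain Q where Q: "Q \<in> K" "snd c x \<in> Q" "Q \<subseteq> snd c ` (fst c \<inter> T)"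
      using topological_basisE[OF K(2)] by metis
    have "{z \<in> fst c. snd c z \<in> Q} \<subseteq> T"
      using Q(3) inj_onD[OF chart_inj[OF ch]] by auto
    moreover have "{z \<in> fst c. snd c z \<in> Q} \<in> \<B>"
      unfolding \<B>_def by (intro UN_I[OF c(1)] imageI Q(1))
    moreover have "x \<in> {z \<in> fst c. snd c z \<in> Q}" using c(2) Q(2) by simp
    ultimately show ?thesis by (intro bexI conjI)
  qed
  ultimately show ?thesis
    unfolding second_countable_def by (intro exI[of _ \<B>]) simp
qed

lemma topological_chart_restrict:
  assumes "topological_chart X (U, \<phi>)" "openin X W"
  shows "topological_chart (subtopology X W) (U \<inter> W, \<phi>)"
  unfolding topological_chart_iff fst_conv snd_conv openin_open_subtopology[OF assms(2)]
proof (intro conjI allI impI)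
  show "openin X (U \<inter> W)"
    using chart_domain[OF assms(1)] assms(2) by auto
  show "inj_on \<phi> (U \<inter> W)"
    using chart_inj[OF assms(1)] by (auto intro: inj_on_subset)
  show "openin X {z \<in> U \<inter> W. \<phi> z \<in> V}" if "open V" for V
  proof -
    have "{z \<in> U \<inter> W. \<phi> z \<in> V} = {z \<in> U. \<phi> z \<in> V} \<inter> W" by auto
    then show ?thesis using chart_preimage[OF assms(1) that] assms(2) by auto
  qed
  show "open (\<phi> ` (U \<inter> W \<inter> T))" if "openin X T \<and> T \<subseteq> W" for T
    using chart_image[OF assms(1), of "W \<inter> T"] that assms(2) by (simp add: inf_assoc openin_Int)
qed auto

lemma smooth_atlas_restrict:
  assumes "smooth_atlas X A" "openin X W"
  shows "smooth_atlas (subtopology X W) (restrict_atlas A W)"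
  unfolding smooth_atlas_iff
proof (intro conjI ballI)
  show "\<Union> (fst ` restrict_atlas A W) = topspace (subtopology X W)"
    using atlas_cover[OF assms(1)] by (force simp: restrict_atlas_def)
  show "topological_chart (subtopology X W) c" if "c \<in> restrict_atlas A W" for c
    using that atlas_chart[OF assms(1)] topological_chart_restrict[OF _ assms(2)]
    by (auto simp: restrict_atlas_def)
  fix c d assume "c \<in> restrict_atlas A W" "d \<in> restrict_atlas A W"
  then obtain U \<phi> V \<psi> where c: "(U, \<phi>) \<in> A" "c = (U \<inter> W, \<phi>)" and d: "(V, \<psi>) \<in> A" "d = (V \<inter> W, \<psi>)"
    by (auto simp: restrict_atlas_def)
  note cU = atlas_chart[OF assms(1) c(1)] and cV = atlas_chart[OF assms(1) d(1)]
  have "openin X (V \<inter> W)"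
    using chart_domain[OF cV] assms(2) by auto
  from chart_image[OF cU this] have "open (\<phi> ` (U \<inter> (V \<inter> W)))" by simp
  moreover have "smooth_on (\<phi> ` (U \<inter> (V \<inter> W))) (\<psi> \<circ> inv_into U \<phi>)"
    using atlas_smooth[OF assms(1) c(1) d(1)] unfolding fst_conv snd_conv
    by (rule smooth_on_subset) auto
  moreover have "inv_into U \<phi> x = inv_into (U \<inter> W) \<phi> x" if "x \<in> \<phi> ` (U \<inter> (V \<inter> W))" for x
    using that chart_inj[OF cU] by (auto simp: inj_on_Int)
  ultimately have "smooth_on (\<phi> ` (U \<inter> (V \<inter> W))) (\<psi> \<circ> inv_into (U \<inter> W) \<phi>)"
    using smooth_on_cong[of "\<phi> ` (U \<inter> (V \<inter> W))" "\<psi> \<circ> inv_into U \<phi>" "\<psi> \<circ> inv_into (U \<inter> W) \<phi>"] by simp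
  then show "smooth_on (snd c ` (fst c \<inter> fst d)) (snd d \<circ> chart_inv c)"
    unfolding c(2) d(2) fst_conv snd_conv by (rule smooth_on_subset) auto
qed

text \<open>The typical \<open>W\<close> is the preimage of an open set under a projection, taken in the whole type;
  only its trace on the space is open.\<close>

lemma smooth_atlas_restrict_preimage:
  assumes "smooth_atlas X A" "openin X (topspace X \<inter> W)"
  shows "smooth_atlas (subtopology X W) (restrict_atlas A W)"
proof -
  have "U \<inter> W = U \<inter> (topspace X \<inter> W)" if "(U, \<phi>) \<in> A" for U \<phi>
    using chart_domain_subset[OF atlas_chart[OF assms(1) that]] by auto
  then have "restrict_atlas A W = restrict_atlas A (topspace X \<inter> W)"
    unfolding restrict_atlas_def by (intro image_cong) auto
  then show ?thesis
    using smooth_atlas_restrict[OF assms] by (simp add: subtopology_restrict)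
qed

lemma topological_chart_prod:
  assumes c: "topological_chart X (U, \<phi>)" and d: "topological_chart Y (V, \<psi>)"
  shows "topological_chart (prod_topology X Y) (U \<times> V, map_prod \<phi> \<psi>)"
  unfolding topological_chart_iff fst_conv snd_conv
proof (intro conjI allI impI)
  show "openin (prod_topology X Y) (U \<times> V)"
    using chart_domain[OF c] chart_domain[OF d] by (simp add: openin_prod_Times_iff)
  show "inj_on (map_prod \<phi> \<psi>) (U \<times> V)"
    using chart_inj[OF c] chart_inj[OF d] by (simp add: map_prod_inj_on)
  show "openin (prod_topology X Y) {z \<in> U \<times> V. map_prod \<phi> \<psi> z \<in> S}" if S: "open S" for S
    unfolding openin_prod_topology_alt
  proof (intro allI impI)
    fix x y assume "(x, y) \<in> {z \<in> U \<times> V. map_prod \<phi> \<psi> z \<in> S}"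
    then have xy: "x \<in> U" "y \<in> V" "(\<phi> x, \<psi> y) \<in> S" by auto
    obtain P Q where "open P" "open Q" "(\<phi> x, \<psi> y) \<in> P \<times> Q" "P \<times> Q \<subseteq> S"
      by (rule open_prod_elim[OF S xy(3)])
    then have PQ: "open P" "open Q" "\<phi> x \<in> P" "\<psi> y \<in> Q" "P \<times> Q \<subseteq> S" by auto
    show "\<exists>P Q. openin X P \<and> openin Y Q \<and> x \<in> P \<and> y \<in> Q \<and> P \<times> Q \<subseteq> {z \<in> U \<times> V. map_prod \<phi> \<psi> z \<in> S}"
      using chart_preimage[OF c PQ(1)] chart_preimage[OF d PQ(2)] PQ xy
      by (intro exI[of _ "{z \<in> U. \<phi> z \<in> P}"] exI[of _ "{z \<in> V. \<psi> z \<in> Q}"]) auto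
  qed
  show "open (map_prod \<phi> \<psi> ` (U \<times> V \<inter> T))" if T: "openin (prod_topology X Y) T" for T
    unfolding open_prod_def
  proof
    fix w assume "w \<in> map_prod \<phi> \<psi> ` (U \<times> V \<inter> T)"
    then obtain x y where xy: "x \<in> U" "y \<in> V" "(x, y) \<in> T" "w = (\<phi> x, \<psi> y)" by auto
    then obtain P Q where PQ: "openin X P" "openin Y Q" "x \<in> P" "y \<in> Q" "P \<times> Q \<subseteq> T"
      using T unfolding openin_prod_topology_alt by meson
    have "open (\<phi> ` (U \<inter> P))" "open (\<psi> ` (V \<inter> Q))"
      using chart_image[OF c PQ(1)] chart_image[OF d PQ(2)] by auto
    moreover have "\<phi> ` (U \<inter> P) \<times> \<psi> ` (V \<inter> Q) \<subseteq> map_prod \<phi> \<psi> ` (U \<times> V \<inter> T)"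
      using PQ(5) by force
    ultimately show "\<exists>A B. open A \<and> open B \<and> w \<in> A \<times> B \<and> A \<times> B \<subseteq> map_prod \<phi> \<psi> ` (U \<times> V \<inter> T)"
      using xy PQ by blast
  qed
qed

text \<open>A bijection along which the charts of the target pull back to charts of the source is a
  diffeomorphism: in coordinates it and its inverse are then transitions of the source. This
  spares a separate calculation for each of the local trivialisations and fibres.\<close>

lemma diffeomorphism_pullback_charts:
  fixes A :: "('a, 'e::euclidean_space) chart set" and B :: "('b, 'e) chart set"
  assumes X: "smooth_atlas X A"
    and Y: "\<Union>(fst ` B) = topspace Y" "\<And>d. d \<in> B \<Longrightarrow> topological_chart Y d"
    and bij: "bij_betw f (topspace X) (topspace Y)"
    and pull: "\<And>d. d \<in> B \<Longrightarrow> \<exists>\<xi>. ({z \<in> topspace X. f z \<in> fst d}, \<xi>) \<in> A \<and>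
      (\<forall>z\<in>topspace X. f z \<in> fst d \<longrightarrow> \<xi> z = snd d (f z))"
  shows "diffeomorphism X A Y B f"
proof -
  define h where "h = inv_into (topspace X) f"
  have hf: "h (f z) = z" if "z \<in> topspace X" for z
    using bij that by (simp add: h_def bij_betw_def)
  have fh: "h y \<in> topspace X" "f (h y) = y" if "y \<in> topspace Y" for y
    using bij that by (auto simp: h_def bij_betw_def inv_into_into f_inv_into_f)
  have fX: "f z \<in> topspace Y" if "z \<in> topspace X" for z
    using bij that by (auto simp: bij_betw_def)
  define D where "D d = {z \<in> topspace X. f z \<in> fst d}" for d :: "('b, 'e) chart"
  have "\<forall>d\<in>B. \<exists>\<xi>. (D d, \<xi>) \<in> A \<and> (\<forall>z\<in>D d. \<xi> z = snd d (f z))"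
  proof
    fix d assume "d \<in> B"
    from pull[OF this] show "\<exists>\<xi>. (D d, \<xi>) \<in> A \<and> (\<forall>z\<in>D d. \<xi> z = snd d (f z))"
      unfolding D_def by auto
  qed
  then obtain \<xi> where "\<forall>d\<in>B. (D d, \<xi> d) \<in> A \<and> (\<forall>z\<in>D d. \<xi> d z = snd d (f z))"
    by (rule bchoice[THEN exE])
  then have \<xi>: "\<And>d. d \<in> B \<Longrightarrow> (D d, \<xi> d) \<in> A" "\<And>d z. d \<in> B \<Longrightarrow> z \<in> D d \<Longrightarrow> \<xi> d z = snd d (f z)"
    by auto
  have cont_f: "continuous_map X Y f"
    unfolding continuous_map_def
  proof (intro conjI allI impI)
    fix T assume T: "openin Y T"
    have "{x \<in> topspace X. f x \<in> T} = (\<Union>d\<in>B. {z \<in> D d. \<xi> d z \<in> snd d ` (fst d \<inter> T)})" (is "?L = ?R")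
    proof
      show "?L \<subseteq> ?R"
      proof
        fix x assume x: "x \<in> ?L"
        then have "f x \<in> \<Union>(fst ` B)" using fX Y(1) by simp
        then obtain d where d: "d \<in> B" "f x \<in> fst d" by blast
        then have "x \<in> D d" using x by (simp add: D_def)
        then show "x \<in> ?R" using \<xi>(2)[OF d(1)] d x by auto
      qed
      show "?R \<subseteq> ?L"
      proof
        fix x assume "x \<in> ?R"
        then obtain d y where d: "d \<in> B" "x \<in> D d" "\<xi> d x = snd d y" "y \<in> fst d" "y \<in> T" by auto
        then have "f x = y"
          using \<xi>(2)[OF d(1,2)] inj_onD[OF chart_inj[OF Y(2)[OF d(1)]], of "f x" y] by (simp add: D_def)
        then show "x \<in> ?L" using d by (simp add: D_def)
      qed
    qed
    moreover have "openin X {z \<in> D d. \<xi> d z \<in> snd d ` (fst d \<inter> T)}" if "d \<in> B" for d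
      using chart_preimage[OF atlas_chart[OF X \<xi>(1)[OF that]]] chart_image[OF Y(2)[OF that] T] by simp
    ultimately show "openin X {x \<in> topspace X. f x \<in> T}" by auto
  qed (use fX in auto)
  have cont_h: "continuous_map Y X h"
    unfolding continuous_map_def
  proof (intro conjI allI impI)
    fix T assume T: "openin X T"
    have "{y \<in> topspace Y. h y \<in> T} = (\<Union>d\<in>B. {y \<in> fst d. snd d y \<in> \<xi> d ` (D d \<inter> T)})" (is "?L = ?R")
    proof
      show "?L \<subseteq> ?R"
      proof
        fix y assume y: "y \<in> ?L"
        then have "y \<in> \<Union>(fst ` B)" using Y(1) by simp
        then obtain d where d: "d \<in> B" "y \<in> fst d" by blast
        have "h y \<in> D d \<inter> T" using y fh d by (auto simp: D_def)
        moreover have "\<xi> d (h y) = snd d y" using \<xi>(2)[OF d(1), of "h y"] calculation y fh by auto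
        ultimately show "y \<in> ?R" using d by force
      qed
      show "?R \<subseteq> ?L"
      proof
        fix y assume "y \<in> ?R"
        then obtain d z where d: "d \<in> B" "y \<in> fst d" "z \<in> D d" "z \<in> T" "snd d y = \<xi> d z" by auto
        then have "y = f z"
          using \<xi>(2)[OF d(1,3)] inj_onD[OF chart_inj[OF Y(2)[OF d(1)]], of y "f z"] by (simp add: D_def)
        then show "y \<in> ?L" using d hf fX by (auto simp: D_def)
      qed
    qed
    moreover have "openin Y {y \<in> fst d. snd d y \<in> \<xi> d ` (D d \<inter> T)}" if "d \<in> B" for d
      using chart_image[OF atlas_chart[OF X \<xi>(1)[OF that]] T] chart_preimage[OF Y(2)[OF that]] by simp
    ultimately show "openin Y {y \<in> topspace Y. h y \<in> T}" by auto
  qed (use fh in auto)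
  have "smooth_map X A Y B f"
    unfolding smooth_map_def
  proof (intro conjI cont_f ballI, clarify)
    fix U \<phi> V \<psi> assume c: "(U, \<phi>) \<in> A" and d: "(V, \<psi>) \<in> B"
    note cU = atlas_chart[OF X c]
    let ?D = "D (V, \<psi>)" and ?\<xi> = "\<xi> (V, \<psi>)"
    have eq: "U \<inter> f -` V = U \<inter> ?D"
      using chart_domain_subset[OF cU] by (auto simp: D_def)
    have "openin X ?D"
      using chart_domain[OF atlas_chart[OF X \<xi>(1)[OF d]]] by simp
    then have o: "open (\<phi> ` (U \<inter> ?D))" using chart_image[OF cU] by simp
    have "smooth_on (\<phi> ` (U \<inter> ?D)) (?\<xi> \<circ> inv_into U \<phi>)"
      using atlas_smooth[OF X c \<xi>(1)[OF d]] by simp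
    then show "smooth_on (\<phi> ` (U \<inter> f -` V)) (\<psi> \<circ> f \<circ> inv_into U \<phi>)"
      unfolding eq
      by (rule smooth_on_cong[OF o, rotated]) (use \<xi>(2)[OF d] chart_inj[OF cU] in auto)
  qed
  moreover have "smooth_map Y B X A h"
    unfolding smooth_map_def
  proof (intro conjI cont_h ballI, clarify)
    fix U \<phi> V \<psi> assume c: "(U, \<phi>) \<in> A" and d: "(V, \<psi>) \<in> B"
    let ?D = "D (V, \<psi>)" and ?\<xi> = "\<xi> (V, \<psi>)"
    note cU = atlas_chart[OF X c] and cV = Y(2)[OF d] and cD = atlas_chart[OF X \<xi>(1)[OF d]]
    have V: "V \<subseteq> topspace Y" using chart_domain_subset[OF cV] by simp
    have eq: "\<psi> ` (V \<inter> h -` U) = ?\<xi> ` (?D \<inter> U)"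
    proof
      show "\<psi> ` (V \<inter> h -` U) \<subseteq> ?\<xi> ` (?D \<inter> U)"
      proof clarify
        fix y assume "y \<in> V" "h y \<in> U"
        then have "h y \<in> ?D \<inter> U" "?\<xi> (h y) = \<psi> y"
          using V fh \<xi>(2)[OF d, of "h y"] by (auto simp: D_def subset_iff)
        then show "\<psi> y \<in> ?\<xi> ` (?D \<inter> U)" by (metis imageI)
      qed
      show "?\<xi> ` (?D \<inter> U) \<subseteq> \<psi> ` (V \<inter> h -` U)"
        using \<xi>(2)[OF d] hf by (auto simp: D_def)
    qed
    have "openin X U" using chart_domain[OF cU] by simp
    then have o: "open (?\<xi> ` (?D \<inter> U))" using chart_image[OF cD] by simp
    have "smooth_on (?\<xi> ` (?D \<inter> U)) (\<phi> \<circ> inv_into ?D ?\<xi>)"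
      using atlas_smooth[OF X \<xi>(1)[OF d] c] by simp
    then show "smooth_on (\<psi> ` (V \<inter> h -` U)) (\<phi> \<circ> h \<circ> inv_into V \<psi>)"
      unfolding eq
    proof (rule smooth_on_cong[OF o, rotated])
      fix x assume "x \<in> ?\<xi> ` (?D \<inter> U)"
      then obtain z where z: "z \<in> ?D" "z \<in> U" "x = ?\<xi> z" by auto
      then have "inv_into ?D ?\<xi> x = z" using chart_inv_eq[OF cD] by simp
      moreover have "inv_into V \<psi> x = f z"
        using chart_inv_eq[OF cV, of "f z"] z \<xi>(2)[OF d] by (simp add: D_def)
      ultimately show "(\<phi> \<circ> inv_into ?D ?\<xi>) x = (\<phi> \<circ> h \<circ> inv_into V \<psi>) x"
        using hf z by (simp add: D_def)
    qed
  qed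
  ultimately show ?thesis
    unfolding diffeomorphism_def using hf fh by blast
qed

lemma smooth_on_empty: "smooth_on {} f"
proof -
  have "C_on k {} f" for k
    by (induction k arbitrary: f) auto
  then show ?thesis by (simp add: smooth_on_def)
qed

text \<open>In charts adapted to \<open>pr\<close> a fibre is the slice on which the first coordinate is constant,
  so its transitions are the transitions of the total space with the first argument frozen.\<close>

lemma smooth_atlas_fibre:
  fixes AZ :: "('z, 'e::euclidean_space \<times> 'f::euclidean_space) chart set"
  assumes X: "smooth_atlas X AZ"
    and adapted: "\<And>c. c \<in> AZ \<Longrightarrow> \<exists>\<phi>. inj_on \<phi> (pr ` fst c) \<and> (\<forall>z\<in>fst c. fst (snd c z) = \<phi> (pr z))"
  shows "smooth_atlas (subtopology X {z. pr z = p}) (fibre_atlas AZ pr p)"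
proof -
  let ?F = "{z. pr z = p}"
  obtain \<phi> where \<phi>: "\<And>c. c \<in> AZ \<Longrightarrow> inj_on (\<phi> c) (pr ` fst c)"
    "\<And>c z. c \<in> AZ \<Longrightarrow> z \<in> fst c \<Longrightarrow> fst (snd c z) = \<phi> c (pr z)"
    using adapted by metis
  have slice: "(snd \<circ> snd c) ` (fst c \<inter> T \<inter> ?F) = (\<lambda>y. (\<phi> c p, y)) -` (snd c ` (fst c \<inter> T))"
    (is "?L = ?R") if c: "c \<in> AZ" "fst c \<inter> ?F \<noteq> {}" for c T
  proof
    show "?L \<subseteq> ?R"
    proof
      fix y assume "y \<in> ?L"
      then obtain z where z: "z \<in> fst c" "z \<in> T" "pr z = p" "y = snd (snd c z)" by auto
      then have "snd c z = (\<phi> c p, y)" using \<phi>(2)[OF c(1) z(1)] by (simp add: prod_eq_iff)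
      then show "y \<in> ?R" using z by (auto intro!: image_eqI[of _ _ z])
    qed
    show "?R \<subseteq> ?L"
    proof
      fix y assume "y \<in> ?R"
      then obtain z where z: "z \<in> fst c" "z \<in> T" "snd c z = (\<phi> c p, y)" by auto
      then have "\<phi> c (pr z) = \<phi> c p" using \<phi>(2)[OF c(1) z(1)] by simp
      then have "pr z = p" using \<phi>(1)[OF c(1)] z(1) c(2) by (auto dest: inj_onD)
      then show "y \<in> ?L" using z by (auto intro!: image_eqI[of _ _ z])
    qed
  qed
  have slice_open: "open ((snd \<circ> snd c) ` (fst c \<inter> T \<inter> ?F))" if c: "c \<in> AZ" "openin X T" for c T
  proof (cases "fst c \<inter> ?F = {}")
    case True
    then have "fst c \<inter> T \<inter> ?F = {}" by auto
    then show ?thesis by simp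
  next
    case False
    show ?thesis
      unfolding slice[OF c(1) False]
      by (intro open_vimage chart_image[OF atlas_chart[OF X c(1)] c(2)] continuous_intros)
  qed
  have inj: "inj_on (snd \<circ> snd c) (fst c \<inter> ?F)" if c: "c \<in> AZ" for c
  proof (rule inj_onI)
    fix z w assume zw: "z \<in> fst c \<inter> ?F" "w \<in> fst c \<inter> ?F" "(snd \<circ> snd c) z = (snd \<circ> snd c) w"
    then have "snd c z = snd c w"
      using \<phi>(2)[OF c, of z] \<phi>(2)[OF c, of w] by (simp add: prod_eq_iff)
    then show "z = w"
      using inj_onD[OF chart_inj[OF atlas_chart[OF X c]]] zw by blast
  qed
  have dom: "fibre_atlas AZ pr p = (\<lambda>c. (fst c \<inter> ?F, snd \<circ> snd c)) ` AZ"
    unfolding fibre_atlas_def by (intro image_cong) (auto simp: case_prod_beta)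
  show ?thesis
    unfolding smooth_atlas_iff dom ball_simps fst_conv snd_conv
  proof (intro conjI ballI)
    show "\<Union> (fst ` (\<lambda>c. (fst c \<inter> ?F, snd \<circ> snd c)) ` AZ) = topspace (subtopology X ?F)"
      using atlas_cover[OF X] by auto
    fix c assume c: "c \<in> AZ"
    note cc = atlas_chart[OF X c]
    show "topological_chart (subtopology X ?F) (fst c \<inter> ?F, snd \<circ> snd c)"
      unfolding topological_chart_iff fst_conv snd_conv
    proof (intro conjI allI impI inj c)
      show "openin (subtopology X ?F) (fst c \<inter> ?F)"
        using chart_domain[OF cc] by (auto simp: openin_subtopology)
      show "openin (subtopology X ?F) {z \<in> fst c \<inter> ?F. (snd \<circ> snd c) z \<in> V}" if "open V" for V
        unfolding openin_subtopology
        using chart_preimage[OF cc, of "UNIV \<times> V"] that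
        by (intro exI[of _ "{z \<in> fst c. snd c z \<in> UNIV \<times> V}"]) (auto simp: open_Times mem_Times_iff)
      show "open ((snd \<circ> snd c) ` (fst c \<inter> ?F \<inter> T))" if "openin (subtopology X ?F) T" for T
      proof -
        obtain T' where T': "openin X T'" "T = T' \<inter> ?F"
          using \<open>openin (subtopology X ?F) T\<close> by (auto simp: openin_subtopology)
        have "fst c \<inter> ?F \<inter> T = fst c \<inter> T' \<inter> ?F" using T'(2) by auto
        then show ?thesis using slice_open[OF c T'(1)] by simp
      qed
    qed
    fix d assume d: "d \<in> AZ"
    have eq: "fst c \<inter> ?F \<inter> (fst d \<inter> ?F) = fst c \<inter> fst d \<inter> ?F" by auto
    let ?S = "(snd \<circ> snd c) ` (fst c \<inter> fst d \<inter> ?F)"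
    have "smooth_on ?S ((snd \<circ> snd d) \<circ> inv_into (fst c \<inter> ?F) (snd \<circ> snd c))"
    proof (cases "fst c \<inter> ?F = {}")
      case True
      then have "?S = {}" by auto
      then show ?thesis using smooth_on_empty by metis
    next
      case False
      have S: "open ?S"
        by (rule slice_open[OF c chart_domain[OF atlas_chart[OF X d]]])
      have op: "open (snd c ` (fst c \<inter> fst d))"
        by (rule chart_image[OF cc chart_domain[OF atlas_chart[OF X d]]])
      have "smooth_on ?S (\<lambda>y. (snd d \<circ> chart_inv c) (\<phi> c p, y))"
        by (rule smooth_on_compose[OF atlas_smooth[OF X c d]])
          (use slice[OF c False] S op in \<open>auto intro!: smooth_on_Pair smooth_on_const smooth_on_ident\<close>)
      then have "smooth_on ?S (\<lambda>y. snd ((snd d \<circ> chart_inv c) (\<phi> c p, y)))"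
        by (rule smooth_on_linear[OF S bounded_linear_snd])
      then show ?thesis
      proof (rule smooth_on_cong[OF S, rotated])
        fix y assume "y \<in> ?S"
        then obtain z where z: "z \<in> fst c" "z \<in> fst d" "z \<in> ?F" "y = (snd \<circ> snd c) z" by auto
        then have "(\<phi> c p, y) = snd c z"
          using \<phi>(2)[OF c z(1)] by (simp add: prod_eq_iff)
        then have "chart_inv c (\<phi> c p, y) = z" using chart_inv_eq[OF cc z(1)] by simp
        moreover have "inv_into (fst c \<inter> ?F) (snd \<circ> snd c) y = z"
          using inv_into_f_f[OF inj[OF c], of z] z by simp
        ultimately show "snd ((snd d \<circ> chart_inv c) (\<phi> c p, y)) =
            ((snd \<circ> snd d) \<circ> inv_into (fst c \<inter> ?F) (snd \<circ> snd c)) y"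
          by simp
      qed
    qed
    then show "smooth_on ((snd \<circ> snd c) ` (fst c \<inter> ?F \<inter> (fst d \<inter> ?F)))
        ((snd \<circ> snd d) \<circ> inv_into (fst c \<inter> ?F) (snd \<circ> snd c))"
      by (simp only: eq)
  qed
qed


section \<open>Minkowski space and the split null cone\<close>

lemma UNIV_4_from_0: "(UNIV :: 4 set) = {0, 1, 2, 3}"
proof -
  have "(4 :: 4) = 0" by simp
  then have "x \<in> {0, 1, 2, 3}" for x :: 4
    using exhaust_4[of x] by (metis insertCI)
  then show ?thesis by blast
qed

lemma sum_UNIV_4_from_0: "(\<Sum>a\<in>UNIV. f a) = f 0 + f 1 + f 2 + f (3::4)"
  unfolding UNIV_4_from_0 by (simp add: add.assoc)

definition minkowski :: "real^4 \<Rightarrow> real^4 \<Rightarrow> real" where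
  "minkowski u v = (\<Sum>a\<in>UNIV. \<Sum>b\<in>UNIV. eta a b * u $ a * v $ b)"

lemma spatial_nth [simp]: "spatial u $ 1 = u $ 1" "spatial u $ 2 = u $ 2" "spatial u $ 3 = u $ 3"
  by (simp_all add: spatial_def)

lemma minkowski_eq: "minkowski u v = spatial u \<bullet> spatial v - u $ 0 * v $ 0"
  by (simp add: minkowski_def sum_UNIV_4_from_0 eta_def inner_vec_def sum_3)

lemma spatial_cone_param [simp]: "spatial (cone_param \<sigma> y) = y"
  by (simp add: vec_eq_iff forall_3 cone_param_def)

lemma cone_param_nth_0 [simp]: "cone_param \<sigma> y $ 0 = \<sigma> * norm y"
  by (simp add: cone_param_def)

lemma vec4_eqI:
  assumes "u $ 0 = v $ 0" "spatial u = spatial v"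
  shows "u = v"
proof -
  have "u $ a = v $ a" if "a \<in> {0, 1, 2, 3}" for a
    using that assms(1) spatial_nth[of u] spatial_nth[of v] assms(2) by auto
  then show ?thesis
    unfolding vec_eq_iff using UNIV_4_from_0 by blast
qed

lemma split_null_cone_iff: "u \<in> split_null_cone \<longleftrightarrow> u \<noteq> 0 \<and> \<bar>u $ 0\<bar> = norm (spatial u)"
proof -
  have "minkowski u u = 0 \<longleftrightarrow> (norm (spatial u))\<^sup>2 = (u $ 0)\<^sup>2"
    by (simp add: minkowski_eq power2_norm_eq_inner) (simp add: power2_eq_square)
  also have "\<dots> \<longleftrightarrow> \<bar>u $ 0\<bar> = norm (spatial u)"
    by (metis abs_norm_cancel power2_eq_iff_nonneg abs_ge_zero power2_abs)
  finally show ?thesis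
    by (simp add: split_null_cone_def minkowski_def)
qed

lemma spatial_zero [simp]: "spatial 0 = 0"
  by (simp add: vec_eq_iff forall_3)

lemma split_null_cone_nth_0: "u \<in> split_null_cone \<Longrightarrow> u $ 0 \<noteq> 0"
  unfolding split_null_cone_iff using vec4_eqI[of u 0] by force

lemma cone_component_iff:
  assumes "\<sigma> \<in> {1, -1}"
  shows "u \<in> cone_param \<sigma> ` (- {0}) \<longleftrightarrow> u \<in> split_null_cone \<and> \<sigma> * u $ 0 > 0"
proof
  assume "u \<in> cone_param \<sigma> ` (- {0})"
  then obtain y where y: "y \<noteq> 0" "u = cone_param \<sigma> y" by auto
  then have "u $ 0 \<noteq> 0" using assms by auto
  then have "u \<noteq> 0" by auto
  then show "u \<in> split_null_cone \<and> \<sigma> * u $ 0 > 0"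
    using y assms \<open>u \<noteq> 0\<close> unfolding split_null_cone_iff by auto
next
  assume u: "u \<in> split_null_cone \<and> \<sigma> * u $ 0 > 0"
  then have "u $ 0 = \<sigma> * norm (spatial u)"
    using assms unfolding split_null_cone_iff by (auto simp: abs_if split: if_splits)
  then have "u = cone_param \<sigma> (spatial u)" "spatial u \<noteq> 0"
    using u by (auto intro: vec4_eqI)
  then show "u \<in> cone_param \<sigma> ` (- {0})" by auto
qed

lemma split_null_cone_components:
  "split_null_cone = null_cone_plus \<union> null_cone_minus" "null_cone_plus \<inter> null_cone_minus = {}"
proof -
  have plus: "u \<in> null_cone_plus \<longleftrightarrow> u \<in> split_null_cone \<and> u $ 0 > 0"
    and minus: "u \<in> null_cone_minus \<longleftrightarrow> u \<in> split_null_cone \<and> u $ 0 < 0" for u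
    using cone_component_iff[of 1 u] cone_component_iff[of "-1" u]
    by (simp_all add: null_cone_plus_def null_cone_minus_def)
  show "split_null_cone = null_cone_plus \<union> null_cone_minus"
  proof (rule set_eqI)
    fix u show "u \<in> split_null_cone \<longleftrightarrow> u \<in> null_cone_plus \<union> null_cone_minus"
      using split_null_cone_nth_0[of u] by (auto simp: plus minus)
  qed
  show "null_cone_plus \<inter> null_cone_minus = {}"
    using plus minus by fastforce
qed

text \<open>By Cauchy--Schwarz the time components dominate in the product of a null and a timelike
  vector, so its sign tells the two components of the cone apart.\<close>

lemma minkowski_null_timelike_sign:
  assumes "minkowski t t < 0" "t $ 0 > 0" "u \<in> split_null_cone" "\<sigma> \<in> {1, -1}"
  shows "\<sigma> * minkowski u t < 0 \<longleftrightarrow> \<sigma> * u $ 0 > 0"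
proof -
  have "(norm (spatial t))\<^sup>2 < (t $ 0)\<^sup>2"
    using assms(1) by (simp add: minkowski_eq power2_norm_eq_inner) (simp add: power2_eq_square)
  then have t: "norm (spatial t) < t $ 0"
    using assms(2) by (simp add: power_less_imp_less_base)
  have "\<bar>spatial u \<bullet> spatial t\<bar> \<le> \<bar>u $ 0\<bar> * norm (spatial t)"
    using Cauchy_Schwarz_ineq2[of "spatial u" "spatial t"] assms(3) by (simp add: split_null_cone_iff)
  also have "\<dots> < \<bar>u $ 0\<bar> * t $ 0"
    using t split_null_cone_nth_0[OF assms(3)] by simp
  finally have "\<bar>spatial u \<bullet> spatial t\<bar> < \<bar>u $ 0\<bar> * t $ 0" .
  then show ?thesis
    using assms(2,4) split_null_cone_nth_0[OF assms(3)]
    by (cases "u $ 0 > 0") (auto simp: minkowski_eq abs_if zero_less_mult_iff mult_less_0_iff split: if_splits)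
qed

lemma bounded_linear_spatial: "bounded_linear spatial"
  unfolding linear_conv_bounded_linear[symmetric]
  by (rule linearI) (simp_all add: vec_eq_iff forall_3)

lemma smooth_on_spatial: "open S \<Longrightarrow> smooth_on S f \<Longrightarrow> smooth_on S (\<lambda>x. spatial (f x))"
  by (rule smooth_on_linear[OF _ bounded_linear_spatial])

lemma smooth_on_cone_param: "smooth_on (- {0}) (cone_param \<sigma>)"
proof (rule smooth_on_vecI)
  fix a :: 4
  have "smooth_on (- {0}) (\<lambda>x :: real^3. \<sigma> * norm x)" "smooth_on (- {0}) (\<lambda>x :: real^3. x $ i)" for i
    by (auto intro!: smooth_on_mult smooth_on_const smooth_on_norm smooth_on_nth smooth_on_ident)
  then show "smooth_on (- {0}) (\<lambda>x. cone_param \<sigma> x $ a)"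
    by (cases "a = 0"; cases "a = 1"; cases "a = 2") (simp_all add: cone_param_def)
qed auto

lemma topological_chart_cone_component:
  assumes \<sigma>: "\<sigma> \<in> {1, -1}"
  shows "topological_chart (top_of_set split_null_cone) (cone_param \<sigma> ` (- {0}), spatial)"
  unfolding topological_chart_iff fst_conv snd_conv
proof (intro conjI allI impI)
  have cs: "continuous_on UNIV spatial"
    using bounded_linear_spatial linear_continuous_on by blast
  have open_half: "open {u :: real^4. \<sigma> * u $ 0 > 0}"
    by (intro open_Collect_less continuous_intros)
  show pre: "openin (top_of_set split_null_cone) {z \<in> cone_param \<sigma> ` (- {0}). spatial z \<in> V}" if "open V" for V
    unfolding openin_open
  proof (intro exI conjI)
    show "open ({u. \<sigma> * u $ 0 > 0} \<inter> spatial -` V)"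
      using open_half continuous_open_vimage[OF that] cs by (auto simp: continuous_on_eq_continuous_at intro!: open_Int open_vimage[OF that])
    show "{z \<in> cone_param \<sigma> ` (- {0}). spatial z \<in> V} = split_null_cone \<inter> ({u. \<sigma> * u $ 0 > 0} \<inter> spatial -` V)"
      using cone_component_iff[OF \<sigma>] by blast
  qed
  show "openin (top_of_set split_null_cone) (cone_param \<sigma> ` (- {0}))"
    using pre[of UNIV] by simp
  show "inj_on spatial (cone_param \<sigma> ` (- {0}))"
    by (auto intro: inj_onI)
  show "open (spatial ` (cone_param \<sigma> ` (- {0}) \<inter> T))" if T: "openin (top_of_set split_null_cone) T" for T
  proof -
    obtain O' where O': "open O'" "T = split_null_cone \<inter> O'"
      using T by (auto simp: openin_open)
    have "spatial ` (cone_param \<sigma> ` (- {0}) \<inter> T) = (- {0}) \<inter> cone_param \<sigma> -` O'"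
    proof
      show "spatial ` (cone_param \<sigma> ` (- {0}) \<inter> T) \<subseteq> (- {0}) \<inter> cone_param \<sigma> -` O'"
        using O'(2) by auto
      show "(- {0}) \<inter> cone_param \<sigma> -` O' \<subseteq> spatial ` (cone_param \<sigma> ` (- {0}) \<inter> T)"
      proof
        fix y assume y: "y \<in> (- {0}) \<inter> cone_param \<sigma> -` O'"
        then have "cone_param \<sigma> y \<in> cone_param \<sigma> ` (- {0})" by auto
        moreover from this have "cone_param \<sigma> y \<in> T"
          unfolding O'(2) cone_component_iff[OF \<sigma>] using y by simp
        ultimately show "y \<in> spatial ` (cone_param \<sigma> ` (- {0}) \<inter> T)"
          by (intro image_eqI[of _ _ "cone_param \<sigma> y"]) auto
      qed
    qed
    then show ?thesis
      using continuous_open_preimage[OF smooth_on_imp_continuous_on[OF smooth_on_cone_param] open_Compl[OF closed_singleton] O'(1)]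
      by simp
  qed
qed

lemma cone_atlas_iff: "c \<in> cone_atlas \<longleftrightarrow> (\<exists>\<sigma>\<in>{1, -1}. c = (cone_param \<sigma> ` (- {0}), spatial))"
  by (auto simp: cone_atlas_def null_cone_plus_def null_cone_minus_def)

lemma cone_component_disjoint:
  assumes "\<sigma> \<in> {1, -1}" "\<sigma>' \<in> {1, -1}" "\<sigma> \<noteq> \<sigma>'"
  shows "cone_param \<sigma> ` (- {0}) \<inter> cone_param \<sigma>' ` (- {0}) = {}"
  using assms split_null_cone_components(2) unfolding null_cone_plus_def null_cone_minus_def
  by auto

lemma smooth_atlas_cone: "smooth_atlas (top_of_set split_null_cone) cone_atlas"
  unfolding smooth_atlas_iff
proof (intro conjI ballI)
  show "\<Union> (fst ` cone_atlas) = topspace (top_of_set split_null_cone)"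
    by (simp add: cone_atlas_def split_null_cone_components(1))
  show "topological_chart (top_of_set split_null_cone) c" if "c \<in> cone_atlas" for c
    using that topological_chart_cone_component unfolding cone_atlas_iff by blast
  fix c d assume "c \<in> cone_atlas" "d \<in> cone_atlas"
  then obtain \<sigma> \<sigma>' where c: "\<sigma> \<in> {1, -1}" "c = (cone_param \<sigma> ` (- {0}), spatial)"
    and d: "\<sigma>' \<in> {1, -1}" "d = (cone_param \<sigma>' ` (- {0}), spatial)"
    unfolding cone_atlas_iff by blast
  show "smooth_on (snd c ` (fst c \<inter> fst d)) (snd d \<circ> chart_inv c)"
  proof (cases "\<sigma> = \<sigma>'")
    case True
    have inv: "chart_inv c x = cone_param \<sigma> x" if "x \<in> - {0}" for x
      using chart_inv_eq[OF topological_chart_cone_component[OF c(1)], of "cone_param \<sigma> x"] that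
      by (simp add: c(2))
    have im: "snd c ` (fst c \<inter> fst d) = - {0}"
      by (simp add: c(2) d(2) True image_image)
    show ?thesis
      unfolding im by (rule smooth_on_cong[OF _ _ smooth_on_ident]) (auto simp: inv d(2))
  next
    case False
    then have "fst c \<inter> fst d = {}"
      using cone_component_disjoint[OF c(1) d(1)] by (simp add: c(2) d(2))
    then show ?thesis using smooth_on_empty by (metis image_empty)
  qed
qed

lemma smooth_manifold_cone: "smooth_manifold (top_of_set split_null_cone) cone_atlas"
  unfolding smooth_manifold_def
proof (intro conjI smooth_atlas_cone)
  show "Hausdorff_space (top_of_set split_null_cone)"
    by (simp add: Hausdorff_space_subtopology)
  show "second_countable (top_of_set split_null_cone)"
  proof (rule second_countable_countable_charts)
    show "countable cone_atlas" by (simp add: cone_atlas_def)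
  qed (use atlas_cover[OF smooth_atlas_cone] atlas_chart[OF smooth_atlas_cone] in auto)
qed


section \<open>Tangent spaces and metrics in coordinates\<close>

text \<open>The tangent vector with components \<open>\<xi>\<close> in the chart \<open>c\<close>.\<close>

definition tangent_of :: "'a chart4 set \<Rightarrow> 'a \<Rightarrow> 'a chart4 \<Rightarrow> real^4 \<Rightarrow> 'a tangent" where
  "tangent_of A p c \<xi> = (\<lambda>d. if d \<in> A \<and> p \<in> fst d
     then frechet_derivative (snd d \<circ> chart_inv c) (at (snd c p)) \<xi> else 0)"

lemma coord_vector_eq_tangent_of: "coord_vector A c p \<mu> = tangent_of A p c (axis \<mu> 1)"
  by (simp add: coord_vector_def tangent_of_def)

context
  fixes X :: "'a topology" and A :: "'a chart4 set"
  assumes X: "smooth_atlas X A"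
begin

lemma open_overlap: "c \<in> A \<Longrightarrow> d \<in> A \<Longrightarrow> open (snd c ` (fst c \<inter> fst d))"
  using chart_image[OF atlas_chart[OF X]] chart_domain[OF atlas_chart[OF X]] by blast

lemma transition_has_derivative:
  assumes "c \<in> A" "d \<in> A" "p \<in> fst c" "p \<in> fst d"
  shows "((snd d \<circ> chart_inv c) has_derivative
    frechet_derivative (snd d \<circ> chart_inv c) (at (snd c p))) (at (snd c p))"
  using assms by (intro smooth_on_has_derivative[OF atlas_smooth[OF X]]) auto

lemma transition_derivative_self:
  assumes "c \<in> A" "p \<in> fst c"
  shows "frechet_derivative (snd c \<circ> chart_inv c) (at (snd c p)) \<xi> = \<xi>"
proof -
  have "((snd c \<circ> chart_inv c) has_derivative (\<lambda>\<xi>. \<xi>)) (at (snd c p))"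
  proof (rule has_derivative_transform_within_open[OF has_derivative_ident])
    show "open (snd c ` fst c)" using open_overlap[OF assms(1,1)] by simp
  qed (use assms chart_inv_eq[OF atlas_chart[OF X assms(1)]] in auto)
  then show ?thesis
    using frechet_derivative_at by metis
qed

text \<open>The chain rule for coordinate changes, which makes any components in one chart extend to a
  consistent family.\<close>

lemma transition_derivative_cocycle:
  assumes c: "c \<in> A" "p \<in> fst c" and d: "d \<in> A" "p \<in> fst d" and e: "e \<in> A" "p \<in> fst e"
  shows "frechet_derivative (snd e \<circ> chart_inv d) (at (snd d p))
      (frechet_derivative (snd d \<circ> chart_inv c) (at (snd c p)) \<xi>)
    = frechet_derivative (snd e \<circ> chart_inv c) (at (snd c p)) \<xi>"
proof -
  let ?D1 = "frechet_derivative (snd d \<circ> chart_inv c) (at (snd c p))"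
  let ?D2 = "frechet_derivative (snd e \<circ> chart_inv d) (at (snd d p))"
  note inv = chart_inv_eq[OF atlas_chart[OF X c(1)]] chart_inv_eq[OF atlas_chart[OF X d(1)]]
  have "(snd d \<circ> chart_inv c) (snd c p) = snd d p"
    by (simp only: o_apply inv(1)[OF c(2)])
  then have "(((snd e \<circ> chart_inv d) \<circ> (snd d \<circ> chart_inv c)) has_derivative (?D2 \<circ> ?D1)) (at (snd c p))"
    using transition_has_derivative[OF c(1) d(1) c(2) d(2)] transition_has_derivative[OF d(1) e(1) d(2) e(2)]
    by (intro diff_chain_at) simp_all
  then have "((snd e \<circ> chart_inv c) has_derivative (?D2 \<circ> ?D1)) (at (snd c p))"
  proof (rule has_derivative_transform_within_open)
    have "openin X (fst d)"
      using chart_domain[OF atlas_chart[OF X d(1)]] .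
    then show "open (snd c ` (fst c \<inter> fst d))"
      by (rule chart_image[OF atlas_chart[OF X c(1)]])
    show "snd c p \<in> snd c ` (fst c \<inter> fst d)" using c d by auto
    fix x assume "x \<in> snd c ` (fst c \<inter> fst d)"
    then obtain z where "z \<in> fst c" "z \<in> fst d" "x = snd c z" by auto
    then show "((snd e \<circ> chart_inv d) \<circ> (snd d \<circ> chart_inv c)) x = (snd e \<circ> chart_inv c) x"
      by (simp only: o_apply inv)
  qed
  then have "?D2 \<circ> ?D1 = frechet_derivative (snd e \<circ> chart_inv c) (at (snd c p))"
    by (rule frechet_derivative_at)
  then show ?thesis by (metis o_apply)
qed

lemma tangent_of_in_tangent_space: "c \<in> A \<Longrightarrow> p \<in> fst c \<Longrightarrow> tangent_of A p c \<xi> \<in> tangent_space A p"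
  unfolding tangent_space_def tangent_of_def using transition_derivative_cocycle by auto

lemma tangent_of_same: "c \<in> A \<Longrightarrow> p \<in> fst c \<Longrightarrow> tangent_of A p c \<xi> c = \<xi>"
  using transition_derivative_self by (simp add: tangent_of_def)

lemma tangent_eqI:
  assumes "v \<in> tangent_space A p" "w \<in> tangent_space A p" "c \<in> A" "p \<in> fst c" "v c = w c"
  shows "v = w"
proof
  fix d show "v d = w d"
  proof (cases "d \<in> A \<and> p \<in> fst d")
    case True
    then have "v d = frechet_derivative (snd d \<circ> chart_inv c) (at (snd c p)) (v c)"
      "w d = frechet_derivative (snd d \<circ> chart_inv c) (at (snd c p)) (w c)"
      using assms(1-4) unfolding tangent_space_def by blast+
    then show ?thesis using assms(5) by simp
  next
    case False
    then have "v d = 0" "w d = 0"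
      using assms(1,2) unfolding tangent_space_def by blast+
    then show ?thesis by simp
  qed
qed

lemma tangent_space_sum:
  assumes "finite F" "\<And>a. a \<in> F \<Longrightarrow> e a \<in> tangent_space A p"
  shows "(\<lambda>c. \<Sum>a\<in>F. r a *\<^sub>R e a c) \<in> tangent_space A p"
proof -
  have "(\<Sum>a\<in>F. r a *\<^sub>R e a d) = frechet_derivative (snd d \<circ> chart_inv c) (at (snd c p)) (\<Sum>a\<in>F. r a *\<^sub>R e a c)"
    if "c \<in> A" "d \<in> A" "p \<in> fst c" "p \<in> fst d" for c d
  proof -
    have "linear (frechet_derivative (snd d \<circ> chart_inv c) (at (snd c p)))"
      using transition_has_derivative[OF that] has_derivative_linear by blast
    then have "frechet_derivative (snd d \<circ> chart_inv c) (at (snd c p)) (\<Sum>a\<in>F. r a *\<^sub>R e a c)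
        = (\<Sum>a\<in>F. r a *\<^sub>R frechet_derivative (snd d \<circ> chart_inv c) (at (snd c p)) (e a c))"
      by (simp add: linear_sum linear_scale)
    also have "\<dots> = (\<Sum>a\<in>F. r a *\<^sub>R e a d)"
    proof (rule sum.cong[OF refl])
      fix a assume "a \<in> F"
      then have "e a d = frechet_derivative (snd d \<circ> chart_inv c) (at (snd c p)) (e a c)"
        using assms(2) that unfolding tangent_space_def by blast
      then show "r a *\<^sub>R frechet_derivative (snd d \<circ> chart_inv c) (at (snd c p)) (e a c) = r a *\<^sub>R e a d"
        by simp
    qed
    finally show ?thesis by simp
  qed
  moreover have "(\<Sum>a\<in>F. r a *\<^sub>R e a d) = 0" if "\<not> (d \<in> A \<and> p \<in> fst d)" for d
  proof (intro sum.neutral ballI)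
    fix a assume "a \<in> F"
    then have "e a d = 0" using assms(2) that unfolding tangent_space_def by blast
    then show "r a *\<^sub>R e a d = 0" by simp
  qed
  ultimately show ?thesis unfolding tangent_space_def by blast
qed

lemma lin_comb_in_tangent_space: "(\<And>a. e a \<in> tangent_space A p) \<Longrightarrow> lin_comb u e \<in> tangent_space A p"
  unfolding lin_comb_def by (rule tangent_space_sum) auto

lemma tangent_eq_lin_comb_coord_vector:
  assumes "c \<in> A" "p \<in> fst c" "v \<in> tangent_space A p"
  shows "v = lin_comb (v c) (coord_vector A c p)"
proof (rule tangent_eqI[OF assms(3) _ assms(1,2)])
  show "lin_comb (v c) (coord_vector A c p) \<in> tangent_space A p"
    using assms by (intro lin_comb_in_tangent_space) (simp add: coord_vector_eq_tangent_of tangent_of_in_tangent_space)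
  show "v c = lin_comb (v c) (coord_vector A c p) c"
    using assms basis_expansion[of "v c"]
    by (simp add: lin_comb_def coord_vector_eq_tangent_of tangent_of_same scalar_mult_eq_scaleR)
qed

text \<open>Smoothness of a vector field has to be tested in every chart. The transformation law
  reduces it to one chart, because transitions and their derivatives are smooth.\<close>

lemma smooth_vector_field_on_tangent_of:
  assumes c: "c \<in> A" and W: "openin X W" "W \<subseteq> fst c" and E: "smooth_on (snd c ` W) E"
  shows "smooth_vector_field_on A W (\<lambda>z. tangent_of A z c (E (snd c z)))"
  unfolding smooth_vector_field_on_def
proof (intro conjI ballI)
  show "tangent_of A z c (E (snd c z)) \<in> tangent_space A z" if "z \<in> W" for z
    using that W(2) by (intro tangent_of_in_tangent_space c) auto
  fix d assume d: "d \<in> A"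
  note cc = atlas_chart[OF X c] and dd = atlas_chart[OF X d]
  let ?S = "snd d ` (fst d \<inter> W)" and ?T = "snd c ` (fst c \<inter> (fst d \<inter> W))"
  have oS: "open ?S" by (rule chart_image[OF dd W(1)])
  have oT: "open ?T" by (rule chart_image[OF cc]) (use chart_domain[OF dd] W(1) in auto)
  have "smooth_on ?T (\<lambda>y. frechet_derivative (snd d \<circ> chart_inv c) (at y) (E y))"
    by (intro smooth_on_frechet_derivative oT smooth_on_subset[OF E]
        smooth_on_subset[OF atlas_smooth[OF X c d]]) auto
  moreover have "smooth_on ?S (snd c \<circ> chart_inv d)"
    by (rule smooth_on_subset[OF atlas_smooth[OF X d c]]) (use W(2) in auto)
  moreover have "(snd c \<circ> chart_inv d) ` ?S \<subseteq> ?T"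
  proof
    fix y assume "y \<in> (snd c \<circ> chart_inv d) ` ?S"
    then obtain z where "z \<in> fst d" "z \<in> W" "y = snd c z"
      by (force simp: chart_inv_eq[OF dd])
    then show "y \<in> ?T" using W(2) by blast
  qed
  ultimately have "smooth_on ?S (\<lambda>x. frechet_derivative (snd d \<circ> chart_inv c) (at ((snd c \<circ> chart_inv d) x))
      (E ((snd c \<circ> chart_inv d) x)))"
    by (rule smooth_on_compose[OF _ _ _ oS oT])
  then show "smooth_on ?S (\<lambda>x. tangent_of A (chart_inv d x) c (E (snd c (chart_inv d x))) d)"
  proof (rule smooth_on_cong[OF oS, rotated])
    fix x assume "x \<in> ?S"
    then obtain z where z: "z \<in> fst d" "x = snd d z" by auto
    then show "frechet_derivative (snd d \<circ> chart_inv c) (at ((snd c \<circ> chart_inv d) x))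
      (E ((snd c \<circ> chart_inv d) x)) = tangent_of A (chart_inv d x) c (E (snd c (chart_inv d x))) d"
      using chart_inv_eq[OF dd z(1)] d by (simp add: tangent_of_def)
  qed
qed

end

text \<open>A component of a vector is up to sign its product with a basis vector, so components in an
  orthonormal frame need no inverse matrix.\<close>

lemma minkowski_axis: "minkowski (axis a 1) u = eta a a * u $ a"
proof -
  have "a \<in> {0, 1, 2, 3}" using UNIV_4_from_0 by blast
  then show ?thesis
    by (auto simp: minkowski_def sum_UNIV_4_from_0 eta_def axis_def)
qed

lemma lin_comb_zero: "lin_comb 0 e = zero_tangent"
  by (simp add: lin_comb_def zero_tangent_def)

lemma lin_comb_axis: "lin_comb (axis a 1) e = e a"
  by (simp add: lin_comb_def axis_def if_distrib[of "\<lambda>x. x *\<^sub>R _"] sum.delta cong: if_cong)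

lemma tangent_basis_frame_components:
  assumes "tangent_basis A p (\<lambda>a. e a p)"
  shows "v \<in> tangent_space A p \<Longrightarrow> lin_comb (frame_components e p v) (\<lambda>a. e a p) = v"
    and "lin_comb u (\<lambda>a. e a p) \<in> tangent_space A p \<Longrightarrow> frame_components e p (lin_comb u (\<lambda>a. e a p)) = u"
proof -
  show "lin_comb (frame_components e p v) (\<lambda>a. e a p) = v" if "v \<in> tangent_space A p" for v
    using theI'[of "\<lambda>u. v = lin_comb u (\<lambda>a. e a p)"] assms that
    unfolding tangent_basis_def frame_components_def by simp
  show "frame_components e p (lin_comb u (\<lambda>a. e a p)) = u"
    if "lin_comb u (\<lambda>a. e a p) \<in> tangent_space A p"
    using the1_equality[of "\<lambda>u'. lin_comb u (\<lambda>a. e a p) = lin_comb u' (\<lambda>a. e a p)" u] assms that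
    unfolding tangent_basis_def frame_components_def by simp
qed

locale spacetime_manifold =
  fixes M :: "'a topology" and A :: "'a chart4 set" and g :: "'a metric_field" and \<tau> :: "'a \<Rightarrow> 'a tangent"
  assumes spacetime: "spacetime M A g \<tau>"
begin

lemma manifold: "smooth_manifold M A" and atlas: "smooth_atlas M A"
  and lorentzian: "lorentzian_metric M A g"
  and \<tau>_smooth: "smooth_vector_field_on A (topspace M) \<tau>"
  and \<tau>_timelike: "p \<in> topspace M \<Longrightarrow> g p (\<tau> p) (\<tau> p) < 0"
  and \<tau>_tangent: "p \<in> topspace M \<Longrightarrow> \<tau> p \<in> tangent_space A p"
  using spacetime by (auto simp: spacetime_def smooth_manifold_def smooth_vector_field_on_def)

lemma obtain_chart:
  assumes "p \<in> topspace M" obtains c where "c \<in> A" "p \<in> fst c"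
proof -
  have "p \<in> \<Union>(fst ` A)" using atlas_cover[OF atlas] assms by simp
  then show ?thesis using that by blast
qed

lemma metric_linear:
  assumes "p \<in> topspace M" "u \<in> tangent_space A p" "v \<in> tangent_space A p" "w \<in> tangent_space A p"
  shows "g p (\<lambda>c. r *\<^sub>R u c + s *\<^sub>R v c) w = r * g p u w + s * g p v w"
  using lorentzian assms unfolding lorentzian_metric_def by blast

lemma metric_sym:
  assumes "p \<in> topspace M" "u \<in> tangent_space A p" "v \<in> tangent_space A p"
  shows "g p u v = g p v u"
  using lorentzian assms unfolding lorentzian_metric_def by blast

lemma metric_sum_left:
  assumes p: "p \<in> topspace M" "finite F" "\<And>a. a \<in> F \<Longrightarrow> e a \<in> tangent_space A p" "w \<in> tangent_space A p"
  shows "g p (\<lambda>c. \<Sum>a\<in>F. r a *\<^sub>R e a c) w = (\<Sum>a\<in>F. r a * g p (e a) w)"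
  using p(2,3)
proof (induction F)
  case empty
  then show ?case
    using metric_linear[OF p(1) p(4) p(4) p(4), of 0 0] by simp
next
  case (insert a F)
  have "(\<lambda>c. \<Sum>a\<in>F. r a *\<^sub>R e a c) \<in> tangent_space A p"
    using insert by (intro tangent_space_sum[OF atlas]) auto
  from metric_linear[OF p(1) _ this p(4), of "e a" "r a" 1] show ?case
    using insert by simp
qed

lemma metric_lin_comb:
  assumes p: "p \<in> topspace M" "\<And>a. e a \<in> tangent_space A p" "\<And>a. f a \<in> tangent_space A p"
  shows "g p (lin_comb u e) (lin_comb v f) = (\<Sum>a\<in>UNIV. \<Sum>b\<in>UNIV. g p (e a) (f b) * u $ a * v $ b)"
proof -
  have f: "lin_comb v f \<in> tangent_space A p"
    by (rule lin_comb_in_tangent_space[OF atlas p(3)])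
  have "g p (lin_comb u e) (lin_comb v f) = (\<Sum>a\<in>UNIV. u $ a * g p (e a) (lin_comb v f))"
    unfolding lin_comb_def[of u e] by (rule metric_sum_left[OF p(1) _ p(2) f]) auto
  also have "\<dots> = (\<Sum>a\<in>UNIV. u $ a * (\<Sum>b\<in>UNIV. v $ b * g p (f b) (e a)))"
  proof (intro sum.cong refl)
    fix a
    have "g p (e a) (lin_comb v f) = g p (lin_comb v f) (e a)"
      by (rule metric_sym[OF p(1) p(2) f])
    also have "\<dots> = (\<Sum>b\<in>UNIV. v $ b * g p (f b) (e a))"
      unfolding lin_comb_def by (rule metric_sum_left[OF p(1) _ p(3) p(2)]) auto
    finally show "u $ a * g p (e a) (lin_comb v f) = u $ a * (\<Sum>b\<in>UNIV. v $ b * g p (f b) (e a))"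
      by simp
  qed
  also have "\<dots> = (\<Sum>a\<in>UNIV. \<Sum>b\<in>UNIV. g p (e a) (f b) * u $ a * v $ b)"
    unfolding sum_distrib_left using metric_sym[OF p(1) p(2) p(3)]
    by (intro sum.cong refl) simp
  finally show ?thesis .
qed

definition metric_coeff :: "'a chart4 \<Rightarrow> 4 \<Rightarrow> 4 \<Rightarrow> real^4 \<Rightarrow> real" where
  "metric_coeff c \<mu> \<nu> x =
     g (chart_inv c x) (coord_vector A c (chart_inv c x) \<mu>) (coord_vector A c (chart_inv c x) \<nu>)"

definition metric_form :: "'a chart4 \<Rightarrow> real^4 \<Rightarrow> real^4 \<Rightarrow> real^4 \<Rightarrow> real" where
  "metric_form c x \<xi> \<zeta> = (\<Sum>\<mu>\<in>UNIV. \<Sum>\<nu>\<in>UNIV. metric_coeff c \<mu> \<nu> x * \<xi> $ \<mu> * \<zeta> $ \<nu>)"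

lemma metric_eq_metric_form:
  assumes c: "c \<in> A" "p \<in> fst c" and v: "v \<in> tangent_space A p" and w: "w \<in> tangent_space A p"
  shows "g p v w = metric_form c (snd c p) (v c) (w c)"
proof -
  note cc = atlas_chart[OF atlas c(1)]
  have p: "p \<in> topspace M" using chart_domain_subset[OF cc] c(2) by auto
  have cv: "coord_vector A c p a \<in> tangent_space A p" for a
    unfolding coord_vector_eq_tangent_of by (rule tangent_of_in_tangent_space[OF atlas c])
  have "g p v w = g p (lin_comb (v c) (coord_vector A c p)) (lin_comb (w c) (coord_vector A c p))"
    using tangent_eq_lin_comb_coord_vector[OF atlas c] v w by simp
  also have "\<dots> = metric_form c (snd c p) (v c) (w c)"
    unfolding metric_form_def metric_coeff_def chart_inv_eq[OF cc c(2)]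
    by (rule metric_lin_comb[OF p cv cv])
  finally show ?thesis .
qed

lemma bilinear_metric_form: "bilinear (metric_form c x)"
  unfolding bilinear_def metric_form_def
  by (intro conjI allI linearI; simp add: sum.distrib[symmetric] sum_distrib_left algebra_simps)

lemma smooth_on_metric_form:
  assumes c: "c \<in> A" and N: "open N" "N \<subseteq> snd c ` fst c" and "smooth_on N X" "smooth_on N Y"
  shows "smooth_on N (\<lambda>x. metric_form c x (X x) (Y x))"
proof -
  have "smooth_on (snd c ` fst c) (metric_coeff c \<mu> \<nu>)" for \<mu> \<nu>
    using lorentzian c unfolding lorentzian_metric_def Let_def metric_coeff_def by blast
  then have "smooth_on N (metric_coeff c \<mu> \<nu>)" for \<mu> \<nu>
    by (rule smooth_on_subset[OF _ N(2)])
  then show ?thesis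
    unfolding metric_form_def using assms
    by (intro smooth_on_sum smooth_on_mult smooth_on_nth) auto
qed

lemma smooth_on_metric:
  assumes c: "c \<in> A" and W: "openin M W" and X: "smooth_vector_field_on A W X" and Y: "smooth_vector_field_on A W Y"
  shows "smooth_on (snd c ` (fst c \<inter> W)) (\<lambda>x. g (chart_inv c x) (X (chart_inv c x)) (Y (chart_inv c x)))"
proof -
  note cc = atlas_chart[OF atlas c]
  let ?S = "snd c ` (fst c \<inter> W)"
  have o: "open ?S" by (rule chart_image[OF cc W])
  have "smooth_on ?S (\<lambda>x. metric_form c x (X (chart_inv c x) c) (Y (chart_inv c x) c))"
    using X Y c by (intro smooth_on_metric_form c o) (auto simp: smooth_vector_field_on_def)
  then show ?thesis
  proof (rule smooth_on_cong[OF o, rotated])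
    fix x assume "x \<in> ?S"
    then obtain z where z: "z \<in> fst c" "z \<in> W" "x = snd c z" by auto
    have "X z \<in> tangent_space A z" "Y z \<in> tangent_space A z"
      using X Y z(2) by (auto simp: smooth_vector_field_on_def)
    then show "metric_form c x (X (chart_inv c x) c) (Y (chart_inv c x) c) =
      g (chart_inv c x) (X (chart_inv c x)) (Y (chart_inv c x))"
      using metric_eq_metric_form[OF c z(1)] chart_inv_eq[OF cc z(1)] by (simp add: z(3))
  qed
qed

lemma metric_orthonormal:
  assumes "p \<in> topspace M" "\<And>a. e a \<in> tangent_space A p" "\<And>a b. g p (e a) (e b) = eta a b"
  shows "g p (lin_comb u e) (lin_comb v e) = minkowski u v"
  unfolding metric_lin_comb[OF assms(1,2,2)] assms(3) minkowski_def ..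

text \<open>Four orthonormal vectors are independent, because the components of a combination are
  recovered by pairing with the vectors; in a chart they form an injective, hence surjective,
  linear map of \<open>\<real>\<^sup>4\<close>.\<close>

lemma orthonormal_basisI:
  assumes p: "p \<in> topspace M" and e: "\<And>a. e a \<in> tangent_space A p" and orth: "\<And>a b. g p (e a) (e b) = eta a b"
  shows "orthonormal_basis A g p e"
proof -
  obtain c where c: "c \<in> A" "p \<in> fst c" using obtain_chart[OF p] .
  define L where "L u = lin_comb u e c" for u
  have inj: "u = v" if uv: "lin_comb u e = lin_comb v e" for u v
  proof -
    have "eta a a * u $ a = eta a a * v $ a" for a
      using metric_orthonormal[of p e "axis a 1", OF p e orth] uv minkowski_axis by metis
    moreover have "eta a a \<noteq> 0" for a by (simp add: eta_def)
    ultimately show ?thesis by (simp add: vec_eq_iff)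
  qed
  have lin: "linear L"
    unfolding L_def lin_comb_def
    by (rule linearI) (simp_all add: algebra_simps sum.distrib scaleR_sum_right)
  have "inj L"
  proof (rule injI)
    fix u v assume "L u = L v"
    then have "lin_comb u e = lin_comb v e"
      unfolding L_def using c e lin_comb_in_tangent_space[OF atlas, of e p]
      by (intro tangent_eqI[OF atlas _ _ c]) auto
    then show "u = v" by (rule inj)
  qed
  then have surj: "surj L"
    by (rule linear_inj_imp_surj[OF lin])
  have "\<exists>!u. v = lin_comb u e" if v: "v \<in> tangent_space A p" for v
  proof -
    obtain u where "v c = L u" using surj by (metis surjD)
    then have "v = lin_comb u e"
      unfolding L_def using lin_comb_in_tangent_space[OF atlas e]
      by (intro tangent_eqI[OF atlas v _ c]) auto
    then show ?thesis using inj by blast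
  qed
  then show ?thesis
    unfolding orthonormal_basis_def tangent_basis_def using e orth by blast
qed

lemma orthonormal_basisD:
  assumes "orthonormal_basis A g p e"
  shows "e a \<in> tangent_space A p" "g p (e a) (e b) = eta a b" "tangent_basis A p e"
  using assms by (auto simp: orthonormal_basis_def tangent_basis_def)

end


section \<open>Local vierbeins\<close>

text \<open>The Gram--Schmidt process for an indefinite form. Starting from vectors that are already
  orthonormal at \<open>x0\<close>, each step changes nothing at \<open>x0\<close>, so the square of the next vector keeps its
  sign near \<open>x0\<close>. This takes the place of positive definiteness when the vector is normalised.\<close>

lemma local_gram_schmidt:
  fixes b :: "'x::euclidean_space \<Rightarrow> 'v::real_normed_vector \<Rightarrow> 'v \<Rightarrow> real" and e0 :: "'i \<Rightarrow> 'v"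
    and \<epsilon> :: "'i \<Rightarrow> real"
  assumes S: "open S" "x0 \<in> S"
    and bil: "\<And>x. x \<in> S \<Longrightarrow> bilinear (b x)"
    and sym: "\<And>x v w. x \<in> S \<Longrightarrow> b x v w = b x w v"
    and smooth: "\<And>N X Y. open N \<Longrightarrow> N \<subseteq> S \<Longrightarrow> smooth_on N X \<Longrightarrow> smooth_on N Y \<Longrightarrow>
      smooth_on N (\<lambda>x. b x (X x) (Y x))"
    and \<epsilon>: "\<And>i. \<epsilon> i * \<epsilon> i = 1"
    and orth: "\<And>i j. b x0 (e0 i) (e0 j) = (if i = j then \<epsilon> i else 0)"
    and F: "finite F"
  shows "\<exists>N e. open N \<and> x0 \<in> N \<and> N \<subseteq> S \<and> (\<forall>i. smooth_on N (e i) \<and> e i x0 = e0 i) \<and>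
    (\<forall>x\<in>N. \<forall>i\<in>F. \<forall>j\<in>F. b x (e i x) (e j x) = (if i = j then \<epsilon> i else 0))"
  using F
proof (induction F)
  case empty
  show ?case
    using S by (intro exI[of _ S] exI[of _ "\<lambda>i x. e0 i"]) (auto intro: smooth_on_const)
next
  case (insert k F)
  then obtain N e where N: "open N" "x0 \<in> N" "N \<subseteq> S"
    and e: "\<And>i. smooth_on N (e i)" "\<And>i. e i x0 = e0 i"
    and orthF: "\<And>x i j. x \<in> N \<Longrightarrow> i \<in> F \<Longrightarrow> j \<in> F \<Longrightarrow> b x (e i x) (e j x) = (if i = j then \<epsilon> i else 0)"
    by blast
  define Y where "Y x = e k x - (\<Sum>i\<in>F. (\<epsilon> i * b x (e k x) (e i x)) *\<^sub>R e i x)" for x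
  define q where "q x = \<epsilon> k * b x (Y x) (Y x)" for x
  \<comment> \<open>As \<open>q x0 = 1\<close>, this is a neighbourhood of \<open>x0\<close>.\<close>
  define N' where "N' = N \<inter> q -` {0<..}"
  define f where "f = e(k := \<lambda>x. q x powr (-1/2) *\<^sub>R Y x)"
  have lin: "linear (\<lambda>v. b x v w)" "linear (\<lambda>w. b x v w)" if "x \<in> N" for x v w
    using bil[of x] that N(3) by (auto simp: bilinear_def)
  have Y_smooth: "smooth_on N Y"
    unfolding Y_def
    by (intro smooth_on_diff smooth_on_sum smooth_on_scaleR smooth_on_mult smooth_on_const smooth e N)
  have q_smooth: "smooth_on N q"
    unfolding q_def by (intro smooth_on_mult smooth_on_const smooth Y_smooth N)
  have Y_orth: "b x (Y x) (e j x) = 0" if x: "x \<in> N" and j: "j \<in> F" for x j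
  proof -
    have "b x (Y x) (e j x) = b x (e k x) (e j x) - (\<Sum>i\<in>F. \<epsilon> i * b x (e k x) (e i x) * b x (e i x) (e j x))"
      unfolding Y_def by (simp add: linear_diff[OF lin(1)[OF x]] linear_sum[OF lin(1)[OF x]] linear_scale[OF lin(1)[OF x]])
    also have "(\<Sum>i\<in>F. \<epsilon> i * b x (e k x) (e i x) * b x (e i x) (e j x))
        = (\<Sum>i\<in>F. if i = j then \<epsilon> i * b x (e k x) (e i x) * \<epsilon> i else 0)"
      by (intro sum.cong refl) (simp add: orthF[OF x _ j])
    also have "\<dots> = \<epsilon> j * b x (e k x) (e j x) * \<epsilon> j"
      using j insert.hyps(1) by (simp add: sum.delta')
    also have "\<dots> = b x (e k x) (e j x)"
      using \<epsilon>[of j] by (simp add: mult.commute mult.left_commute)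
    finally show ?thesis by simp
  qed
  have Y0: "Y x0 = e0 k"
    unfolding Y_def using insert.hyps(2) by (auto simp: e(2) orth intro!: sum.neutral)
  have q0: "q x0 = 1"
    by (simp add: q_def Y0 orth \<epsilon>)
  have N': "open N'" "x0 \<in> N'" "N' \<subseteq> N"
    unfolding N'_def using q0 N(2)
    by (auto intro!: continuous_open_preimage smooth_on_imp_continuous_on[OF q_smooth] N(1))
  have q_pos: "q x > 0" if "x \<in> N'" for x using that by (simp add: N'_def)
  have f_smooth: "smooth_on N' (f i)" for i
  proof (cases "i = k")
    case True
    have "smooth_on N' (\<lambda>x. q x powr (-1/2) *\<^sub>R Y x)"
      using q_pos by (intro smooth_on_scaleR smooth_on_powr N' smooth_on_subset[OF q_smooth] smooth_on_subset[OF Y_smooth])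
    then show ?thesis using True by (simp add: f_def)
  next
    case False
    then show ?thesis using smooth_on_subset[OF e(1) N'(3)] by (simp add: f_def)
  qed
  moreover have "f i x0 = e0 i" for i
    by (simp add: f_def q0 Y0 e(2))
  moreover have "b x (f i x) (f j x) = (if i = j then \<epsilon> i else 0)"
    if x: "x \<in> N'" and ij: "i \<in> insert k F" "j \<in> insert k F" for x i j
  proof -
    have xN: "x \<in> N" using x N'(3) by blast
    note L = linear_scale[OF lin(1)[OF xN]] linear_scale[OF lin(2)[OF xN]]
    have kj: "b x (f k x) (f j x) = 0" if "j \<in> F" for j
      using that insert.hyps(2) Y_orth[OF xN] by (auto simp: f_def L)
    have kk: "b x (f k x) (f k x) = \<epsilon> k"
    proof -
      have "b x (f k x) (f k x) = (q x powr (-1/2) * q x powr (-1/2)) * b x (Y x) (Y x)"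
        by (simp add: f_def L)
      also have "b x (Y x) (Y x) = \<epsilon> k * q x"
        using \<epsilon>[of k] by (simp add: q_def mult.assoc[symmetric])
      also have "q x powr (-1/2) * q x powr (-1/2) = inverse (q x)"
        using q_pos[OF x] by (simp add: powr_minus powr_half_sqrt flip: inverse_mult_distrib)
      finally show ?thesis using q_pos[OF x] by simp
    qed
    have sym': "b x v w = b x w v" for v w using sym xN N(3) by blast
    consider "i = k" "j = k" | "i = k" "j \<in> F" | "i \<in> F" "j = k" | "i \<in> F" "j \<in> F"
      using ij by blast
    then show ?thesis
    proof cases
      case 3
      then show ?thesis using kj[of i] sym'[of "f i x" "f k x"] insert.hyps(2) by auto
    next
      case 4
      then show ?thesis using orthF[OF xN] insert.hyps(2) by (auto simp: f_def)
    qed (use kj kk insert.hyps(2) in auto)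
  qed
  ultimately show ?case
    using N' N(3) by (intro exI[of _ N'] exI[of _ f]) auto
qed

text \<open>In a frame \<open>\<tau>\<close> becomes a timelike vector of Minkowski space, and pairing with \<open>\<tau>\<close> becomes the
  Minkowski product with it. Its time component cannot vanish, since a spatial vector has
  nonnegative square.\<close>

lemma (in spacetime_manifold) timelike_components:
  assumes p: "p \<in> topspace M" and e: "orthonormal_basis A g p (\<lambda>a. e a p)"
  defines "t \<equiv> frame_components e p (\<tau> p)"
  shows "minkowski t t < 0" "g p (e 0 p) (\<tau> p) = - t $ 0" "t $ 0 \<noteq> 0"
    "g p (lin_comb u (\<lambda>a. e a p)) (\<tau> p) = minkowski u t"
proof -
  have t: "\<tau> p = lin_comb t (\<lambda>a. e a p)"
    unfolding t_def using tangent_basis_frame_components(1)[of A p e, OF orthonormal_basisD(3)[OF e] \<tau>_tangent[OF p]] by simp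
  have m: "g p (lin_comb u (\<lambda>a. e a p)) (\<tau> p) = minkowski u t" for u
    unfolding t by (rule metric_orthonormal[OF p]) (use orthonormal_basisD[OF e] in auto)
  then show "g p (lin_comb u (\<lambda>a. e a p)) (\<tau> p) = minkowski u t" .
  have "g p (\<tau> p) (\<tau> p) = minkowski t t"
    using m[of t] t by simp
  then show tt: "minkowski t t < 0"
    using \<tau>_timelike[OF p] by simp
  show "g p (e 0 p) (\<tau> p) = - t $ 0"
    using m[of "axis 0 1"] by (simp add: lin_comb_axis minkowski_axis eta_def)
  show "t $ 0 \<noteq> 0"
  proof
    assume "t $ 0 = 0"
    then have "spatial t \<bullet> spatial t < 0" using tt by (simp add: minkowski_eq)
    then show False using inner_ge_zero[of "spatial t"] by linarith
  qed
qed

text \<open>If \<open>e 0\<close> is past directed, replacing it by its negative keeps the basis orthonormal.\<close>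

lemma (in spacetime_manifold) exists_oriented_orthonormal_basis:
  assumes p: "p \<in> topspace M"
  obtains e where "\<And>a. e a \<in> tangent_space A p" "\<And>a b. g p (e a) (e b) = eta a b" "g p (e 0) (\<tau> p) < 0"
proof -
  obtain e where e: "orthonormal_basis A g p e"
    using lorentzian p unfolding lorentzian_metric_def by blast
  \<comment> \<open>The factor \<open>s\<close> turns \<open>e 0\<close> to the future.\<close>
  define s :: real where "s = (if g p (e 0) (\<tau> p) < 0 then 1 else - 1)"
  define r :: "4 \<Rightarrow> real" where "r a = (if a = 0 then s else 1)" for a
  define f where "f a = lin_comb (r a *\<^sub>R axis a 1) e" for a
  have f_tangent: "f a \<in> tangent_space A p" for a
    unfolding f_def by (rule lin_comb_in_tangent_space[OF atlas orthonormal_basisD(1)[OF e]])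
  have scale: "minkowski (r *\<^sub>R u) (s *\<^sub>R v) = r * s * minkowski u v" for r s u v
    by (simp add: minkowski_def sum_distrib_left algebra_simps)
  have "g p (f a) (f b) = eta a b" for a b
  proof -
    have "g p (f a) (f b) = minkowski (r a *\<^sub>R axis a 1) (r b *\<^sub>R axis b 1)"
      unfolding f_def by (rule metric_orthonormal[OF p]) (use orthonormal_basisD[OF e] in auto)
    also have "\<dots> = r a * r b * (eta a a * (axis b 1 :: real^4) $ a)"
      by (simp only: scale minkowski_axis)
    also have "\<dots> = eta a b"
      by (auto simp: axis_def eta_def r_def s_def)
    finally show ?thesis .
  qed
  moreover have "g p (f 0) (\<tau> p) < 0"
  proof -
    note tc = timelike_components[OF p, of "\<lambda>a _. e a", OF e]
    have "g p (f 0) (\<tau> p) = s * g p (e 0) (\<tau> p)"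
      using tc(4)[of "s *\<^sub>R axis 0 1"] tc(4)[of "1 *\<^sub>R axis 0 1"]
        scale[of s "axis 0 1" 1] scale[of 1 "axis 0 1" 1]
      by (simp add: f_def r_def lin_comb_axis)
    then show ?thesis
      using tc(2,3) by (auto simp: s_def)
  qed
  ultimately show ?thesis using f_tangent that by blast
qed

text \<open>An orthonormal basis at one point, extended with constant components in a chart, is
  orthonormalised near the point. The time-orientation of \<open>e 0\<close> persists by continuity.\<close>

lemma (in spacetime_manifold) exists_local_vierbein:
  assumes p: "p \<in> topspace M"
  shows "\<exists>c\<in>A. \<exists>W e. openin M W \<and> p \<in> W \<and> W \<subseteq> fst c \<and> vierbein_on A g \<tau> W e"
proof -
  obtain c where c: "c \<in> A" "p \<in> fst c" using obtain_chart[OF p] .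
  note cc = atlas_chart[OF atlas c(1)]
  have sub: "fst c \<subseteq> topspace M" by (rule chart_domain_subset[OF cc])
  obtain e0 where e0: "\<And>a. e0 a \<in> tangent_space A p" "\<And>a b. g p (e0 a) (e0 b) = eta a b"
    "g p (e0 0) (\<tau> p) < 0"
    using exists_oriented_orthonormal_basis[OF p] by metis
  let ?S = "snd c ` fst c"
  have S: "open ?S" using open_overlap[OF atlas c(1) c(1)] by simp
  have eta_if: "eta a b = (if a = b then eta a a else 0)" for a b by (simp add: eta_def)
  have sym: "metric_form c x v w = metric_form c x w v" if x: "x \<in> ?S" for x v w
  proof -
    obtain z where z: "z \<in> fst c" "x = snd c z" using x by auto
    note t = tangent_of_in_tangent_space[OF atlas c(1) z(1)]
    have "g z (tangent_of A z c v) (tangent_of A z c w) = g z (tangent_of A z c w) (tangent_of A z c v)"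
      using z(1) sub by (intro metric_sym t) auto
    then show ?thesis
      using metric_eq_metric_form[OF c(1) z(1) t t] tangent_of_same[OF atlas c(1) z(1)] z(2) by simp
  qed
  have "\<exists>N E. open N \<and> snd c p \<in> N \<and> N \<subseteq> ?S \<and> (\<forall>a. smooth_on N (E a) \<and> E a (snd c p) = e0 a c) \<and>
    (\<forall>x\<in>N. \<forall>a\<in>UNIV. \<forall>b\<in>UNIV. metric_form c x (E a x) (E b x) = (if a = b then eta a a else 0))"
  proof (rule local_gram_schmidt[OF S])
    show "metric_form c (snd c p) (e0 a c) (e0 b c) = (if a = b then eta a a else 0)" for a b
      using metric_eq_metric_form[OF c e0(1) e0(1)] e0(2) eta_if by metis
    show "smooth_on N (\<lambda>x. metric_form c x (X x) (Y x))"
      if "open N" "N \<subseteq> ?S" "smooth_on N X" "smooth_on N Y" for N X Y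
      by (rule smooth_on_metric_form[OF c(1) that])
  qed (use c sym bilinear_metric_form in \<open>auto simp: eta_def\<close>)
  then obtain N E where N: "open N" "snd c p \<in> N" "N \<subseteq> ?S"
    and E: "\<And>a. smooth_on N (E a)" "\<And>a. E a (snd c p) = e0 a c"
    and orth: "\<And>x a b. x \<in> N \<Longrightarrow> metric_form c x (E a x) (E b x) = eta a b"
    using eta_if by auto metis
  define e where "e a z = tangent_of A z c (E a (snd c z))" for a z
  define h where "h x = metric_form c x (E 0 x) (\<tau> (chart_inv c x) c)" for x
  define N' where "N' = N \<inter> h -` {..<0}"
  define W where "W = {z \<in> fst c. snd c z \<in> N'}"
  have \<tau>_c: "smooth_on ?S (\<lambda>x. \<tau> (chart_inv c x) c)"
    using \<tau>_smooth c(1) sub by (auto simp: smooth_vector_field_on_def inf_absorb1)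
  have "smooth_on N h"
    unfolding h_def by (intro smooth_on_metric_form c(1) N E smooth_on_subset[OF \<tau>_c])
  then have N': "open N'"
    unfolding N'_def by (intro continuous_open_preimage smooth_on_imp_continuous_on N) auto
  have W: "openin M W" "W \<subseteq> fst c"
    unfolding W_def using chart_preimage[OF cc N'] by auto
  have W_image: "snd c ` W \<subseteq> N" by (auto simp: W_def N'_def)
  have g_e: "g z (e a z) w = metric_form c (snd c z) (E a (snd c z)) (w c)"
    and e_tangent: "e a z \<in> tangent_space A z"
    if "z \<in> fst c" "w \<in> tangent_space A z" for z a w
    using metric_eq_metric_form[OF c(1) that(1) tangent_of_in_tangent_space[OF atlas c(1) that(1)] that(2)]
      tangent_of_same[OF atlas c(1) that(1)] tangent_of_in_tangent_space[OF atlas c(1) that(1)]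
    by (simp_all add: e_def)
  have h_eq: "h (snd c z) = g z (e 0 z) (\<tau> z)" if "z \<in> fst c" for z
    using g_e[OF that \<tau>_tangent, of 0] that sub chart_inv_eq[OF cc that] by (auto simp: h_def)
  have "p \<in> W"
  proof -
    have "e 0 p = e0 0"
      by (rule tangent_eqI[OF atlas _ e0(1) c])
        (simp_all add: e_def tangent_of_in_tangent_space[OF atlas c] tangent_of_same[OF atlas c] E(2))
    then have "h (snd c p) < 0" using h_eq[OF c(2)] e0(3) by simp
    then show ?thesis using c(2) N(2) by (simp add: W_def N'_def)
  qed
  moreover have "vierbein_on A g \<tau> W e"
    unfolding vierbein_on_def
  proof (intro conjI allI ballI)
    show "smooth_vector_field_on A W (e a)" for a
      unfolding e_def
      by (rule smooth_vector_field_on_tangent_of[OF atlas c(1) W smooth_on_subset[OF E(1) W_image]])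
    fix z assume z: "z \<in> W"
    then have zc: "z \<in> fst c" and zN: "snd c z \<in> N" and h0: "h (snd c z) < 0" by (auto simp: W_def N'_def)
    have zM: "z \<in> topspace M" using zc sub by auto
    have et: "e a z \<in> tangent_space A z" for a using e_tangent[OF zc \<tau>_tangent[OF zM]] .
    show "orthonormal_basis A g z (\<lambda>a. e a z)"
    proof (rule orthonormal_basisI[OF zM et])
      show "g z (e a z) (e b z) = eta a b" for a b
        using g_e[OF zc et, of a b] orth[OF zN, of a b] tangent_of_same[OF atlas c(1) zc]
        by (simp add: e_def)
    qed
    show "g z (e 0 z) (\<tau> z) < 0" using h_eq[OF zc] h0 by simp
  qed
  ultimately show ?thesis using c(1) W by blast
qed


section \<open>Null charts and their transitions\<close>

lemma smooth_on_fst_comp: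
  fixes S :: "('a::euclidean_space \<times> 'b::euclidean_space) set"
  assumes "open S" "open T" "fst ` S \<subseteq> T" "smooth_on T f"
  shows "smooth_on S (\<lambda>z. f (fst z))"
  using assms by (intro smooth_on_compose[of T f S fst] smooth_on_linear[OF _ bounded_linear_fst] smooth_on_ident) auto

lemma smooth_on_snd_comp:
  fixes S :: "('a::euclidean_space \<times> 'b::euclidean_space) set"
  assumes "open S" "open T" "snd ` S \<subseteq> T" "smooth_on T f"
  shows "smooth_on S (\<lambda>z. f (snd z))"
  using assms by (intro smooth_on_compose[of T f S snd] smooth_on_linear[OF _ bounded_linear_snd] smooth_on_ident) auto

context spacetime_manifold
begin

lemma vierbein_on_subset:
  assumes "vierbein_on A g \<tau> W e" "openin M W" "openin M W'" "W' \<subseteq> W"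
  shows "vierbein_on A g \<tau> W' e"
proof -
  have "smooth_vector_field_on A W' (e a)" for a
    using assms smooth_on_subset unfolding vierbein_on_def smooth_vector_field_on_def
    by (meson image_mono inf_mono order_refl subsetD)
  then show ?thesis using assms unfolding vierbein_on_def by blast
qed

lemma frame_lin_comb_tangent:
  assumes "orthonormal_basis A g p (\<lambda>a. e a p)"
  shows "lin_comb u (\<lambda>a. e a p) \<in> tangent_space A p"
  by (rule lin_comb_in_tangent_space[OF atlas orthonormal_basisD(1)[OF assms]])

lemma frame_components_lin_comb:
  assumes "orthonormal_basis A g p (\<lambda>a. e a p)"
  shows "frame_components e p (lin_comb u (\<lambda>a. e a p)) = u"
  by (rule tangent_basis_frame_components(2)[of A p e, OF orthonormal_basisD(3)[OF assms] frame_lin_comb_tangent[of p e, OF assms]])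

lemma lin_comb_frame_components:
  assumes "orthonormal_basis A g p (\<lambda>a. e a p)" "v \<in> tangent_space A p"
  shows "lin_comb (frame_components e p v) (\<lambda>a. e a p) = v"
  by (rule tangent_basis_frame_components(1)[of A p e, OF orthonormal_basisD(3)[OF assms(1)] assms(2)])

lemma frame_components_nth:
  assumes p: "p \<in> topspace M" and e: "orthonormal_basis A g p (\<lambda>a. e a p)" and v: "v \<in> tangent_space A p"
  shows "frame_components e p v $ b = eta b b * g p v (e b p)"
proof -
  let ?t = "frame_components e p v"
  have "g p (e b p) v = g p (lin_comb (axis b 1) (\<lambda>a. e a p)) (lin_comb ?t (\<lambda>a. e a p))"
    using lin_comb_frame_components[of p e, OF e v] by (simp add: lin_comb_axis)
  also have "\<dots> = eta b b * ?t $ b"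
    using metric_orthonormal[OF p, of "\<lambda>a. e a p"] orthonormal_basisD[OF e] by (simp add: minkowski_axis)
  finally show ?thesis
    using metric_sym[OF p v orthonormal_basisD(1)[OF e]] by (simp add: eta_def)
qed

text \<open>This makes the transitions between two vierbeins smooth: the components in the new frame
  are pairings with its vectors, so no frame has to be inverted.\<close>

lemma frame_components_change:
  assumes p: "p \<in> topspace M" and e: "orthonormal_basis A g p (\<lambda>a. e a p)"
    and f: "orthonormal_basis A g p (\<lambda>a. f a p)"
  shows "frame_components f p (lin_comb u (\<lambda>a. e a p)) $ b
    = eta b b * (\<Sum>a\<in>UNIV. u $ a * g p (e a p) (f b p))"
proof -
  have "g p (lin_comb u (\<lambda>a. e a p)) (f b p) = (\<Sum>a\<in>UNIV. u $ a * g p (e a p) (f b p))"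
    unfolding lin_comb_def
    by (rule metric_sum_left[OF p]) (use orthonormal_basisD(1)[OF e] orthonormal_basisD(1)[OF f] in auto)
  then show ?thesis
    using frame_components_nth[of p f, OF p f frame_lin_comb_tangent[of p e, OF e]] by simp
qed

text \<open>An orthonormal frame identifies the nonzero null vectors of a tangent space with the split
  null cone, because it turns the metric into the Minkowski product.\<close>

lemma lin_comb_null_iff:
  assumes p: "p \<in> topspace M" and e: "orthonormal_basis A g p (\<lambda>a. e a p)"
  shows "(p, lin_comb u (\<lambda>a. e a p)) \<in> null_bundle M A g \<longleftrightarrow> u \<in> split_null_cone"
proof -
  have "lin_comb u (\<lambda>a. e a p) = zero_tangent \<longleftrightarrow> u = 0"
    using frame_components_lin_comb[of p e, OF e] lin_comb_zero by metis
  moreover have "g p (lin_comb u (\<lambda>a. e a p)) (lin_comb u (\<lambda>a. e a p)) = minkowski u u"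
    by (rule metric_orthonormal[OF p]) (use orthonormal_basisD[OF e] in auto)
  ultimately show ?thesis
    using p frame_lin_comb_tangent[of p e, OF e]
    by (auto simp: null_bundle_def null_vectors_def split_null_cone_def minkowski_def)
qed

lemma null_bundle_frame_components:
  assumes W: "openin M W" "vierbein_on A g \<tau> W e" and z: "z \<in> null_bundle M A g" "fst z \<in> W"
  defines "u \<equiv> frame_components e (fst z) (snd z)"
  shows "z = (fst z, lin_comb u (\<lambda>a. e a (fst z)))" "u \<in> split_null_cone"
    "\<sigma> \<in> {1, -1} \<Longrightarrow> \<sigma> * g (fst z) (snd z) (\<tau> (fst z)) < 0 \<longleftrightarrow> u \<in> cone_param \<sigma> ` (- {0})"
proof -
  obtain p v where pv: "z = (p, v)" by (cases z)
  have p: "p \<in> topspace M" and pW: "p \<in> W" and v: "v \<in> tangent_space A p"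
    using z by (auto simp: pv null_bundle_def null_vectors_def)
  have e: "orthonormal_basis A g p (\<lambda>a. e a p)" and e0: "g p (e 0 p) (\<tau> p) < 0"
    using W(2) pW by (auto simp: vierbein_on_def)
  have vu: "v = lin_comb u (\<lambda>a. e a p)"
    using lin_comb_frame_components[of p e, OF e v] by (simp add: u_def pv)
  then show "z = (fst z, lin_comb u (\<lambda>a. e a (fst z)))" by (simp add: pv)
  show u: "u \<in> split_null_cone"
    using lin_comb_null_iff[of p e, OF p e, of u] z(1) by (simp add: pv vu)
  show "\<sigma> * g (fst z) (snd z) (\<tau> (fst z)) < 0 \<longleftrightarrow> u \<in> cone_param \<sigma> ` (- {0})" if \<sigma>: "\<sigma> \<in> {1, -1}"
  proof -
    note tc = timelike_components[of p e, OF p e]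
    let ?t = "frame_components e p (\<tau> p)"
    have "?t $ 0 > 0" using tc(2) e0 by simp
    from minkowski_null_timelike_sign[OF tc(1) this u \<sigma>] show ?thesis
      using tc(4)[of u] u by (simp add: pv vu cone_component_iff[OF \<sigma>])
  qed
qed

text \<open>The domain depends on the sign and on \<open>W\<close> only, not on the coordinates or the frame. Two null
  charts therefore overlap over the intersection of their base domains, or not at all.\<close>

lemma null_chart_domain:
  "fst (null_chart M A g \<tau> \<sigma> W \<phi> e) =
    {z \<in> null_bundle M A g. fst z \<in> W \<and> \<sigma> * g (fst z) (snd z) (\<tau> (fst z)) < 0}"
  by (auto simp: null_chart_def)

text \<open>The inverse of a null chart in the fibre direction: over \<open>p\<close> it inverts
  \<open>v \<mapsto> spatial (frame_components e p v)\<close> on the vectors of sign \<open>\<sigma>\<close>.\<close>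

definition null_lift :: "(4 \<Rightarrow> 'a \<Rightarrow> 'a tangent) \<Rightarrow> real \<Rightarrow> 'a \<Rightarrow> real^3 \<Rightarrow> 'a \<times> 'a tangent" where
  "null_lift e \<sigma> p y = (p, lin_comb (cone_param \<sigma> y) (\<lambda>a. e a p))"

lemma fst_null_lift [simp]: "fst (null_lift e \<sigma> p y) = p"
  by (simp add: null_lift_def)

lemma null_chart_null_lift:
  assumes "openin M W" "vierbein_on A g \<tau> W e" "p \<in> W"
  shows "snd (null_chart M A g \<tau> \<sigma> W \<phi> e) (null_lift e \<sigma> p y) = (\<phi> p, y)"
  using assms frame_components_lin_comb[of p e] by (simp add: null_chart_def null_lift_def vierbein_on_def)

lemma null_chart_domain_iff:
  assumes W: "openin M W" "vierbein_on A g \<tau> W e" and \<sigma>: "\<sigma> \<in> {1, -1}"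
  shows "z \<in> fst (null_chart M A g \<tau> \<sigma> W \<phi> e) \<longleftrightarrow> (\<exists>p\<in>W. \<exists>y. y \<noteq> 0 \<and> z = null_lift e \<sigma> p y)"
proof
  assume "z \<in> fst (null_chart M A g \<tau> \<sigma> W \<phi> e)"
  then have z: "z \<in> null_bundle M A g" "fst z \<in> W" "\<sigma> * g (fst z) (snd z) (\<tau> (fst z)) < 0"
    by (auto simp: null_chart_domain)
  obtain y where "y \<noteq> 0" "frame_components e (fst z) (snd z) = cone_param \<sigma> y"
    using null_bundle_frame_components(3)[OF W z(1,2) \<sigma>] z(3) by auto
  then have "z = null_lift e \<sigma> (fst z) y"
    unfolding null_lift_def using null_bundle_frame_components(1)[OF W z(1,2)] by simp
  then show "\<exists>p\<in>W. \<exists>y. y \<noteq> 0 \<and> z = null_lift e \<sigma> p y"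
    using z(2) \<open>y \<noteq> 0\<close> by blast
next
  assume "\<exists>p\<in>W. \<exists>y. y \<noteq> 0 \<and> z = null_lift e \<sigma> p y"
  then obtain p y where p: "p \<in> W" "y \<noteq> 0" "z = null_lift e \<sigma> p y" by blast
  have pM: "p \<in> topspace M" using openin_subset[OF W(1)] p(1) by auto
  have e: "orthonormal_basis A g p (\<lambda>a. e a p)" using W(2) p(1) by (simp add: vierbein_on_def)
  have y: "cone_param \<sigma> y \<in> cone_param \<sigma> ` (- {0})" using p(2) by auto
  then have z: "z \<in> null_bundle M A g"
    unfolding p(3) null_lift_def lin_comb_null_iff[of p e, OF pM e] using cone_component_iff[OF \<sigma>] by blast
  have "frame_components e (fst z) (snd z) = cone_param \<sigma> y"
    using frame_components_lin_comb[of p e, OF e] by (simp add: p(3) null_lift_def)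
  then show "z \<in> fst (null_chart M A g \<tau> \<sigma> W \<phi> e)"
    unfolding null_chart_domain using z null_bundle_frame_components(3)[OF W z _ \<sigma>] y p(1,3) by simp
qed

lemma null_chart_image:
  assumes "openin M W" "vierbein_on A g \<tau> W e" "\<sigma> \<in> {1, -1}" "W' \<subseteq> W"
  shows "snd (null_chart M A g \<tau> \<sigma> W \<phi> e) ` {z \<in> fst (null_chart M A g \<tau> \<sigma> W \<phi> e). fst z \<in> W'} = \<phi> ` W' \<times> (- {0})"
    (is "?L = ?R")
proof
  show "?L \<subseteq> ?R"
    using null_chart_null_lift[OF assms(1,2)] assms(4) by (auto simp: null_chart_domain_iff[OF assms(1-3)])
  show "?R \<subseteq> ?L"
  proof
    fix w assume "w \<in> ?R"
    then obtain p y where p: "p \<in> W'" "y \<noteq> 0" "w = (\<phi> p, y)" by auto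
    then show "w \<in> ?L"
      using null_chart_null_lift[OF assms(1,2), of p \<sigma> \<phi> y] assms(4)
      by (intro image_eqI[of _ _ "null_lift e \<sigma> p y"]) (auto simp: null_chart_domain_iff[OF assms(1-3)])
  qed
qed

lemma null_chart_inj:
  assumes "openin M W" "vierbein_on A g \<tau> W e" "\<sigma> \<in> {1, -1}" "inj_on \<phi> W"
  shows "inj_on (snd (null_chart M A g \<tau> \<sigma> W \<phi> e)) (fst (null_chart M A g \<tau> \<sigma> W \<phi> e))"
proof (rule inj_onI)
  let ?C = "null_chart M A g \<tau> \<sigma> W \<phi> e"
  fix z w assume "z \<in> fst ?C" "w \<in> fst ?C" and eq: "snd ?C z = snd ?C w"
  then obtain p y q x where "p \<in> W" "z = null_lift e \<sigma> p y" "q \<in> W" "w = null_lift e \<sigma> q x"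
    unfolding null_chart_domain_iff[OF assms(1-3)] by blast
  then show "z = w"
    using eq null_chart_null_lift[OF assms(1,2)] inj_onD[OF assms(4), of p q] by simp
qed

lemma null_atlas_iff:
  "C \<in> null_atlas M A g \<tau> \<longleftrightarrow> (\<exists>\<sigma>\<in>{1, -1}. \<exists>c\<in>A. \<exists>W e. C = null_chart M A g \<tau> \<sigma> W (snd c) e \<and>
     openin M W \<and> W \<subseteq> fst c \<and> vierbein_on A g \<tau> W e)"
  unfolding null_atlas_def by force

text \<open>In coordinates \<open>(x, y)\<close> the transition changes \<open>x\<close> by a transition of \<open>M\<close>. It sends \<open>y\<close> through
  \<open>cone_param \<sigma>\<close>, which is smooth away from \<open>0\<close>, through the matrix of products of the two frames,
  which depends smoothly on \<open>x\<close>, and through the projection \<open>spatial\<close>.\<close>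

lemma null_atlas_smooth_transition:
  assumes c: "c \<in> A" and W: "openin M W" "W \<subseteq> fst c" "vierbein_on A g \<tau> W e"
    and d: "d \<in> A" and V: "openin M V" "V \<subseteq> fst d" "vierbein_on A g \<tau> V f" and \<sigma>: "\<sigma> \<in> {1, -1}"
  defines "C \<equiv> null_chart M A g \<tau> \<sigma> W (snd c) e" and "D \<equiv> null_chart M A g \<tau> \<sigma> V (snd d) f"
  shows "smooth_on (snd c ` (W \<inter> V) \<times> (- {0})) (snd D \<circ> chart_inv C)"
proof -
  note cc = atlas_chart[OF atlas c]
  let ?T = "snd c ` (W \<inter> V)"
  have oT: "open ?T"
  proof -
    have "fst c \<inter> (W \<inter> V) = W \<inter> V" using W(2) by auto
    then show ?thesis using chart_image[OF cc openin_Int[OF W(1) V(1)]] by simp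
  qed
  have o0: "open (- {0} :: (real^3) set)" by (rule open_Compl[OF closed_singleton])
  have o: "open (?T \<times> (- {0} :: (real^3) set))" by (rule open_Times[OF oT o0])
  define h where "h a b x = g (chart_inv c x) (e a (chart_inv c x)) (f b (chart_inv c x))" for a b x
  define F where "F z = ((snd d \<circ> chart_inv c) (fst z),
    spatial (\<chi> b. eta b b * (\<Sum>a\<in>UNIV. cone_param \<sigma> (snd z) $ a * h a b (fst z))))" for z
  have h: "smooth_on ?T (h a b)" for a b
  proof -
    have "smooth_vector_field_on A (W \<inter> V) (e a)" "smooth_vector_field_on A (W \<inter> V) (f b)"
      using vierbein_on_subset[OF W(3,1), of "W \<inter> V"] vierbein_on_subset[OF V(3,1), of "W \<inter> V"] W(1) V(1)
      by (auto simp: vierbein_on_def openin_Int)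
    from smooth_on_metric[OF c openin_Int[OF W(1) V(1)] this] show ?thesis
      unfolding h_def by (rule smooth_on_subset) (use W(2) in auto)
  qed
  have "smooth_on (?T \<times> (- {0})) F"
    unfolding F_def
  proof (intro smooth_on_Pair o smooth_on_spatial)
    have "smooth_on ?T (snd d \<circ> chart_inv c)"
      by (rule smooth_on_subset[OF atlas_smooth[OF atlas c d]]) (use W(2) V(2) in auto)
    then show "smooth_on (?T \<times> (- {0})) (\<lambda>z :: (real^4) \<times> (real^3). (snd d \<circ> chart_inv c) (fst z))"
      by (intro smooth_on_fst_comp[OF o oT, of "snd d \<circ> chart_inv c"]) auto
    show "smooth_on (?T \<times> (- {0})) (\<lambda>z. \<chi> b. eta b b * (\<Sum>a\<in>UNIV. cone_param \<sigma> (snd z) $ a * h a b (fst z)))"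
    proof (rule smooth_on_vecI[OF o], unfold vec_lambda_beta,
        intro smooth_on_mult smooth_on_sum smooth_on_const smooth_on_nth o)
      show "smooth_on (?T \<times> (- {0})) (\<lambda>z :: (real^4) \<times> (real^3). h a b (fst z))" for a b
        by (rule smooth_on_fst_comp[OF o oT _ h]) auto
      show "smooth_on (?T \<times> (- {0})) (\<lambda>z :: (real^4) \<times> (real^3). cone_param \<sigma> (snd z))"
        by (rule smooth_on_snd_comp[OF o o0 _ smooth_on_cone_param]) auto
    qed
  qed
  then show ?thesis
  proof (rule smooth_on_cong[OF o, rotated])
    fix w :: "(real^4) \<times> (real^3)" assume "w \<in> ?T \<times> (- {0})"
    then obtain p y where p: "p \<in> W" "p \<in> V" "y \<noteq> 0" "w = (snd c p, y)" by auto
    have pc: "p \<in> fst c" and pM: "p \<in> topspace M" using p(1) W(2) chart_domain_subset[OF cc] by auto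
    have inj: "inj_on (snd c) W" using chart_inj[OF cc] W(2) inj_on_subset by blast
    have inv: "chart_inv C w = null_lift e \<sigma> p y"
      unfolding C_def using p null_chart_null_lift[OF W(1,3) p(1), of \<sigma> "snd c" y]
        null_chart_domain_iff[OF W(1,3) \<sigma>] null_chart_inj[OF W(1,3) \<sigma> inj]
      by (intro inv_into_f_eq) auto
    have "orthonormal_basis A g p (\<lambda>a. e a p)" "orthonormal_basis A g p (\<lambda>a. f a p)"
      using W(3) V(3) p by (auto simp: vierbein_on_def)
    from frame_components_change[of p e f, OF pM this]
    have "frame_components f p (lin_comb (cone_param \<sigma> y) (\<lambda>a. e a p)) =
        (\<chi> b. eta b b * (\<Sum>a\<in>UNIV. cone_param \<sigma> y $ a * h a b (snd c p)))"
      by (simp add: vec_eq_iff h_def chart_inv_eq[OF cc pc])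
    then show "F w = (snd D \<circ> chart_inv C) w"
      using chart_inv_eq[OF cc pc] by (simp add: F_def inv[unfolded p(4)] p(4) D_def null_chart_def null_lift_def)
  qed
qed

lemma null_chart_overlap:
  assumes "\<sigma> \<in> {1, -1}" "\<sigma>' \<in> {1, -1}"
  shows "fst (null_chart M A g \<tau> \<sigma> W \<phi> e) \<inter> fst (null_chart M A g \<tau> \<sigma>' V \<psi> f) =
    (if \<sigma> = \<sigma>' then {z \<in> fst (null_chart M A g \<tau> \<sigma> W \<phi> e). fst z \<in> W \<inter> V} else {})"
  using assms by (auto simp: null_chart_domain)

lemma null_bundle_atlas:
  shows "topspace (null_bundle_topology M A g \<tau>) = \<Union>(fst ` null_atlas M A g \<tau>)"
    and "smooth_atlas (null_bundle_topology M A g \<tau>) (null_atlas M A g \<tau>)"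
proof -
  have inj: "inj_on (snd C) (fst C)" if "C \<in> null_atlas M A g \<tau>" for C
  proof -
    obtain \<sigma> c W e where C: "\<sigma> \<in> {1, -1}" "c \<in> A" "openin M W" "W \<subseteq> fst c" "vierbein_on A g \<tau> W e"
      "C = null_chart M A g \<tau> \<sigma> W (snd c) e"
      using \<open>C \<in> null_atlas M A g \<tau>\<close> unfolding null_atlas_iff by blast
    have "inj_on (snd c) W"
      using chart_inj[OF atlas_chart[OF atlas C(2)]] C(4) inj_on_subset by blast
    then show ?thesis unfolding C(6) by (rule null_chart_inj[OF C(3,5,1)])
  qed
  have ov: "open (snd C ` (fst C \<inter> fst D)) \<and> smooth_on (snd C ` (fst C \<inter> fst D)) (snd D \<circ> chart_inv C)"
    if CD: "C \<in> null_atlas M A g \<tau>" "D \<in> null_atlas M A g \<tau>" for C D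
  proof -
    obtain \<sigma> c W e where C: "\<sigma> \<in> {1, -1}" "c \<in> A" "openin M W" "W \<subseteq> fst c" "vierbein_on A g \<tau> W e"
      "C = null_chart M A g \<tau> \<sigma> W (snd c) e"
      using CD(1) unfolding null_atlas_iff by blast
    obtain \<sigma>' d V f where D: "\<sigma>' \<in> {1, -1}" "d \<in> A" "openin M V" "V \<subseteq> fst d" "vierbein_on A g \<tau> V f"
      "D = null_chart M A g \<tau> \<sigma>' V (snd d) f"
      using CD(2) unfolding null_atlas_iff by blast
    show ?thesis
    proof (cases "\<sigma> = \<sigma>'")
      case True
      have im: "snd C ` (fst C \<inter> fst D) = snd c ` (W \<inter> V) \<times> (- {0})"
        using null_chart_overlap[OF C(1) D(1)] null_chart_image[OF C(3,5,1), of "W \<inter> V"] True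
        by (simp add: C(6) D(6))
      have "fst c \<inter> (W \<inter> V) = W \<inter> V" using C(4) by auto
      then have "open (snd c ` (W \<inter> V))"
        using chart_image[OF atlas_chart[OF atlas C(2)] openin_Int[OF C(3) D(3)]] by simp
      then have "open (snd c ` (W \<inter> V) \<times> (- {0} :: (real^3) set))"
        by (intro open_Times open_Compl closed_singleton)
      then show ?thesis
        unfolding im using null_atlas_smooth_transition[OF C(2-5) D(2-5) C(1)] True C(6) D(6) by simp
    next
      case False
      then have "fst C \<inter> fst D = {}"
        using null_chart_overlap[OF C(1) D(1)] by (simp add: C(6) D(6))
      then show ?thesis using smooth_on_empty by simp
    qed
  qed
  show "topspace (null_bundle_topology M A g \<tau>) = \<Union>(fst ` null_atlas M A g \<tau>)"
    unfolding null_bundle_topology_def by (rule smooth_atlas_atlas_topology(1)) (use inj ov in auto)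
  show "smooth_atlas (null_bundle_topology M A g \<tau>) (null_atlas M A g \<tau>)"
    unfolding null_bundle_topology_def by (rule smooth_atlas_atlas_topology(2)) (use inj ov in auto)
qed

section \<open>The null tangent bundle as a manifold\<close>

lemma null_bundle_sign:
  assumes W: "openin M W" "vierbein_on A g \<tau> W e" and z: "z \<in> null_bundle M A g" "fst z \<in> W"
  shows "\<exists>\<sigma>\<in>{1, -1}. z \<in> fst (null_chart M A g \<tau> \<sigma> W \<phi> e)"
proof -
  let ?u = "frame_components e (fst z) (snd z)"
  have "?u \<in> null_cone_plus \<union> null_cone_minus"
    using null_bundle_frame_components(2)[OF W z] split_null_cone_components(1) by auto
  then obtain \<sigma> :: real where "\<sigma> \<in> {1, -1}" "?u \<in> cone_param \<sigma> ` (- {0})"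
    unfolding null_cone_plus_def null_cone_minus_def by blast
  then show ?thesis
    using null_bundle_frame_components(3)[OF W z] z by (auto simp: null_chart_domain)
qed

text \<open>Vierbeins restrict to open subsets, so the base domain of a null chart can be made small. This
  is why the topology that the charts generate is fine enough for the projection to be
  continuous.\<close>

lemma null_bundle_small_chart:
  assumes z: "z \<in> null_bundle M A g" and S: "openin M S" "fst z \<in> S"
  shows "\<exists>C\<in>null_atlas M A g \<tau>. z \<in> fst C \<and> fst ` fst C \<subseteq> S"
proof -
  have "fst z \<in> topspace M" using z by (auto simp: null_bundle_def)
  then obtain c W e where c: "c \<in> A" "openin M W" "fst z \<in> W" "W \<subseteq> fst c" "vierbein_on A g \<tau> W e"
    using exists_local_vierbein by blast
  have V: "openin M (W \<inter> S)" using c(2) S(1) by blast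
  have e: "vierbein_on A g \<tau> (W \<inter> S) e" by (rule vierbein_on_subset[OF c(5,2) V]) auto
  have "fst z \<in> W \<inter> S" using c(3) S(2) by simp
  from null_bundle_sign[OF V e z this, of "snd c"] obtain \<sigma> where
    \<sigma>: "\<sigma> \<in> {1, -1}" "z \<in> fst (null_chart M A g \<tau> \<sigma> (W \<inter> S) (snd c) e)" by blast
  show ?thesis
  proof (intro bexI conjI)
    show "z \<in> fst (null_chart M A g \<tau> \<sigma> (W \<inter> S) (snd c) e)" by (rule \<sigma>(2))
    show "fst ` fst (null_chart M A g \<tau> \<sigma> (W \<inter> S) (snd c) e) \<subseteq> S" by (auto simp: null_chart_domain)
    show "null_chart M A g \<tau> \<sigma> (W \<inter> S) (snd c) e \<in> null_atlas M A g \<tau>"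
      unfolding null_atlas_iff using \<sigma>(1) c(1,4) V e by blast
  qed
qed

lemma null_bundle_topspace: "topspace (null_bundle_topology M A g \<tau>) = null_bundle M A g"
proof
  show "topspace (null_bundle_topology M A g \<tau>) \<subseteq> null_bundle M A g"
  proof
    fix z assume "z \<in> topspace (null_bundle_topology M A g \<tau>)"
    then obtain C where C: "C \<in> null_atlas M A g \<tau>" "z \<in> fst C"
      unfolding null_bundle_atlas(1) by blast
    then obtain \<sigma> W \<phi> e where "C = null_chart M A g \<tau> \<sigma> W \<phi> e"
      unfolding null_atlas_iff by blast
    then show "z \<in> null_bundle M A g" using C(2) by (simp add: null_chart_domain)
  qed
  show "null_bundle M A g \<subseteq> topspace (null_bundle_topology M A g \<tau>)"
  proof
    fix z assume z: "z \<in> null_bundle M A g"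
    then have "fst z \<in> topspace M" by (auto simp: null_bundle_def)
    from null_bundle_small_chart[OF z openin_topspace this]
    show "z \<in> topspace (null_bundle_topology M A g \<tau>)" unfolding null_bundle_atlas(1) by blast
  qed
qed

lemma null_bundle_proj_open:
  assumes "openin M S"
  shows "openin (null_bundle_topology M A g \<tau>) {z \<in> null_bundle M A g. fst z \<in> S}"
proof -
  define \<C> where "\<C> = {C \<in> null_atlas M A g \<tau>. fst ` fst C \<subseteq> S}"
  have dom: "openin (null_bundle_topology M A g \<tau>) (fst C)" if "C \<in> null_atlas M A g \<tau>" for C
    by (rule chart_domain[OF atlas_chart[OF null_bundle_atlas(2) that]])
  have "{z \<in> null_bundle M A g. fst z \<in> S} = \<Union>(fst ` \<C>)"
  proof
    show "{z \<in> null_bundle M A g. fst z \<in> S} \<subseteq> \<Union>(fst ` \<C>)"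
      using null_bundle_small_chart[OF _ assms] unfolding \<C>_def by blast
    show "\<Union>(fst ` \<C>) \<subseteq> {z \<in> null_bundle M A g. fst z \<in> S}"
      using openin_subset[OF dom] unfolding \<C>_def null_bundle_topspace by blast
  qed
  then show ?thesis using dom unfolding \<C>_def by auto
qed

lemma null_bundle_proj_continuous: "continuous_map (null_bundle_topology M A g \<tau>) M fst"
  unfolding continuous_map_def null_bundle_topspace
  using null_bundle_proj_open by (auto simp: null_bundle_def)

text \<open>Points over different base points are separated in \<open>M\<close>. Two points of the same fibre lie over a
  common vierbein domain, and then either in one chart or in the disjoint charts of opposite
  sign.\<close>

lemma null_bundle_Hausdorff: "Hausdorff_space (null_bundle_topology M A g \<tau>)"
  unfolding Hausdorff_space_def null_bundle_topspace
proof (intro allI impI, elim conjE)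
  fix z w assume z: "z \<in> null_bundle M A g" and w: "w \<in> null_bundle M A g" and "z \<noteq> w"
  let ?E = "null_bundle_topology M A g \<tau>"
  have zM: "fst z \<in> topspace M" and wM: "fst w \<in> topspace M" using z w by (auto simp: null_bundle_def)
  show "\<exists>U V. openin ?E U \<and> openin ?E V \<and> z \<in> U \<and> w \<in> V \<and> disjnt U V"
  proof (cases "fst z = fst w")
    case False
    have "Hausdorff_space M" using manifold by (simp add: smooth_manifold_def)
    then obtain U V where UV: "openin M U" "openin M V" "fst z \<in> U" "fst w \<in> V" "disjnt U V"
      unfolding Hausdorff_space_def using False zM wM by metis
    show ?thesis
      using null_bundle_proj_open[OF UV(1)] null_bundle_proj_open[OF UV(2)] UV z w
      by (intro exI[of _ "{z \<in> null_bundle M A g. fst z \<in> U}"] exI[of _ "{z \<in> null_bundle M A g. fst z \<in> V}"])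
        (auto simp: disjnt_iff)
  next
    case True
    obtain c W e where c: "c \<in> A" "openin M W" "fst z \<in> W" "W \<subseteq> fst c" "vierbein_on A g \<tau> W e"
      using exists_local_vierbein[OF zM] by blast
    obtain \<sigma> where \<sigma>: "\<sigma> \<in> {1, -1}" "z \<in> fst (null_chart M A g \<tau> \<sigma> W (snd c) e)"
      using null_bundle_sign[OF c(2,5) z c(3)] by blast
    obtain \<sigma>' where \<sigma>': "\<sigma>' \<in> {1, -1}" "w \<in> fst (null_chart M A g \<tau> \<sigma>' W (snd c) e)"
      using null_bundle_sign[OF c(2,5) w] c(3) True by auto
    let ?C = "null_chart M A g \<tau> \<sigma> W (snd c) e" and ?D = "null_chart M A g \<tau> \<sigma>' W (snd c) e"
    have C: "topological_chart ?E ?C" and D: "topological_chart ?E ?D"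
      using atlas_chart[OF null_bundle_atlas(2)] null_atlas_iff c \<sigma> \<sigma>' by blast+
    show ?thesis
    proof (cases "\<sigma> = \<sigma>'")
      case False
      then have "disjnt (fst ?C) (fst ?D)"
        using null_chart_overlap[OF \<sigma>(1) \<sigma>'(1)] by (simp add: disjnt_def)
      then show ?thesis using chart_domain[OF C] chart_domain[OF D] \<sigma>(2) \<sigma>'(2) by blast
    next
      case True
      then have wC: "w \<in> fst ?C" using \<sigma>'(2) by simp
      have "snd ?C z \<noteq> snd ?C w"
        using inj_onD[OF chart_inj[OF C] _ \<sigma>(2) wC] \<open>z \<noteq> w\<close> by blast
      then obtain U V where UV: "open U" "open V" "snd ?C z \<in> U" "snd ?C w \<in> V" "U \<inter> V = {}"
        using hausdorff by metis
      show ?thesis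
        using chart_preimage[OF C UV(1)] chart_preimage[OF C UV(2)] UV \<sigma>(2) wC
        by (intro exI[of _ "{x \<in> fst ?C. snd ?C x \<in> U}"] exI[of _ "{x \<in> fst ?C. snd ?C x \<in> V}"])
          (auto simp: disjnt_iff)
    qed
  qed
qed

text \<open>The base is Lindelof, so countably many vierbein domains cover it, and each carries only
  two null charts.\<close>

lemma null_bundle_second_countable: "second_countable (null_bundle_topology M A g \<tau>)"
proof -
  define P where "P W ce \<longleftrightarrow> fst ce \<in> A \<and> W \<subseteq> fst (fst ce) \<and> vierbein_on A g \<tau> W (snd ce)" for W ce
  define \<U> where "\<U> = {W. openin M W \<and> (\<exists>ce. P W ce)}"
  have "Lindelof_space M"
    using manifold by (simp add: smooth_manifold_def second_countable_imp_Lindelof_space)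
  moreover have "\<Union>\<U> = topspace M"
  proof
    show "\<Union>\<U> \<subseteq> topspace M" unfolding \<U>_def using openin_subset by blast
    show "topspace M \<subseteq> \<Union>\<U>"
    proof
      fix p assume "p \<in> topspace M"
      then obtain c W e where "c \<in> A" "openin M W" "p \<in> W" "W \<subseteq> fst c" "vierbein_on A g \<tau> W e"
        using exists_local_vierbein by blast
      then have "openin M W" "P W (c, e)" "p \<in> W" by (auto simp: P_def)
      then show "p \<in> \<Union>\<U>" unfolding \<U>_def by blast
    qed
  qed
  moreover have "openin M U" if "U \<in> \<U>" for U using that by (simp add: \<U>_def)
  ultimately obtain \<V> where \<V>: "countable \<V>" "\<V> \<subseteq> \<U>" "\<Union>\<V> = topspace M"
    unfolding Lindelof_space_def by metis
  have "\<forall>W\<in>\<V>. \<exists>ce. P W ce" using \<V>(2) by (auto simp: \<U>_def)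
  then obtain ce where ce: "\<forall>W\<in>\<V>. P W (ce W)" by (rule bchoice[THEN exE])
  define N where "N \<sigma> W = null_chart M A g \<tau> \<sigma> W (snd (fst (ce W))) (snd (ce W))" for \<sigma> W
  have N: "N \<sigma> W \<in> null_atlas M A g \<tau>" if "\<sigma> \<in> {1, -1}" "W \<in> \<V>" for \<sigma> W
  proof -
    have W: "openin M W" "P W (ce W)"
      using ce that(2) \<V>(2) by (auto simp: \<U>_def)
    show ?thesis
      unfolding null_atlas_iff
    proof (intro bexI exI conjI)
      show "N \<sigma> W = null_chart M A g \<tau> \<sigma> W (snd (fst (ce W))) (snd (ce W))" by (simp only: N_def)
    qed (use W that(1) in \<open>simp_all only: P_def\<close>)
  qed
  show ?thesis
  proof (rule second_countable_countable_charts)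
    show "countable (\<Union>\<sigma>\<in>{1, -1}. N \<sigma> ` \<V>)"
      by (intro countable_UN countable_image \<V>(1)) simp
    show "topological_chart (null_bundle_topology M A g \<tau>) C" if "C \<in> (\<Union>\<sigma>\<in>{1, -1}. N \<sigma> ` \<V>)" for C
      using that N atlas_chart[OF null_bundle_atlas(2)] by blast
    show "topspace (null_bundle_topology M A g \<tau>) \<subseteq> \<Union>(fst ` (\<Union>\<sigma>\<in>{1, -1}. N \<sigma> ` \<V>))"
    proof
      fix z assume "z \<in> topspace (null_bundle_topology M A g \<tau>)"
      then have z: "z \<in> null_bundle M A g" by (simp add: null_bundle_topspace)
      then have "fst z \<in> \<Union>\<V>" using \<V>(3) by (auto simp: null_bundle_def)
      then obtain W where W: "W \<in> \<V>" "fst z \<in> W" by blast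
      then have "openin M W" "vierbein_on A g \<tau> W (snd (ce W))"
        using \<V>(2) ce by (auto simp: \<U>_def P_def)
      from null_bundle_sign[OF this z W(2)] obtain \<sigma> where "\<sigma> \<in> {1, -1}" "z \<in> fst (N \<sigma> W)"
        unfolding N_def by blast
      then show "z \<in> \<Union>(fst ` (\<Union>\<sigma>\<in>{1, -1}. N \<sigma> ` \<V>))" using W(1) by blast
    qed
  qed
qed

lemma null_bundle_manifold: "smooth_manifold (null_bundle_topology M A g \<tau>) (null_atlas M A g \<tau>)"
  unfolding smooth_manifold_def
  using null_bundle_Hausdorff null_bundle_second_countable null_bundle_atlas(2) by blast

lemma null_bundle_proj_smooth:
  "smooth_map (null_bundle_topology M A g \<tau>) (null_atlas M A g \<tau>) M A fst"
  unfolding smooth_map_def case_prod_beta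
proof (intro conjI null_bundle_proj_continuous ballI)
  fix C d assume CA: "C \<in> null_atlas M A g \<tau>" and d: "d \<in> A"
  obtain \<sigma> c W e where C: "\<sigma> \<in> {1, -1}" "c \<in> A" "openin M W" "W \<subseteq> fst c" "vierbein_on A g \<tau> W e"
    "C = null_chart M A g \<tau> \<sigma> W (snd c) e"
    using CA unfolding null_atlas_iff by blast
  note cc = atlas_chart[OF atlas C(2)] and CC = atlas_chart[OF null_bundle_atlas(2) CA]
  let ?T = "snd c ` (W \<inter> fst d)"
  have dom: "fst C \<inter> fst -` fst d = {z \<in> fst C. fst z \<in> W \<inter> fst d}"
    unfolding C(6) null_chart_domain by auto
  have im: "snd C ` (fst C \<inter> fst -` fst d) = ?T \<times> (- {0})"
    unfolding dom unfolding C(6) by (rule null_chart_image[OF C(3,5,1)]) auto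
  have "fst c \<inter> (W \<inter> fst d) = W \<inter> fst d" using C(4) by auto
  then have oT: "open ?T"
    using chart_image[OF cc openin_Int[OF C(3) chart_domain[OF atlas_chart[OF atlas d]]]] by simp
  have o: "open (?T \<times> (- {0} :: (real^3) set))"
    by (intro open_Times oT open_Compl closed_singleton)
  have "smooth_on ?T (snd d \<circ> chart_inv c)"
    by (rule smooth_on_subset[OF atlas_smooth[OF atlas C(2) d]]) (use C(4) in auto)
  then have "smooth_on (?T \<times> (- {0})) (\<lambda>z :: (real^4) \<times> (real^3). (snd d \<circ> chart_inv c) (fst z))"
    by (intro smooth_on_fst_comp[OF o oT, of "snd d \<circ> chart_inv c"]) auto
  then have "smooth_on (?T \<times> (- {0})) (snd d \<circ> fst \<circ> chart_inv C)"
  proof (rule smooth_on_cong[OF o, rotated])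
    fix w :: "(real^4) \<times> (real^3)" assume "w \<in> ?T \<times> (- {0})"
    then have "w \<in> snd C ` (fst C \<inter> fst -` fst d)" by (simp only: im)
    then obtain z where z: "z \<in> fst C" "w = snd C z" by auto
    have zW: "fst z \<in> fst c" "fst w = snd c (fst z)"
      using z C(4) by (auto simp: C(6) null_chart_def)
    show "(snd d \<circ> chart_inv c) (fst w) = (snd d \<circ> fst \<circ> chart_inv C) w"
      using chart_inv_eq[OF CC z(1)] chart_inv_eq[OF cc zW(1)] by (simp add: z(2)[symmetric] zW(2))
  qed
  then show "smooth_on (snd C ` (fst C \<inter> fst -` fst d)) (snd d \<circ> fst \<circ> chart_inv C)"
    by (simp only: im)
qed

section \<open>Local triviality and fibres\<close>

lemma null_bundle_proj_surj: "fst ` null_bundle M A g = topspace M"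
proof
  show "fst ` null_bundle M A g \<subseteq> topspace M" by (auto simp: null_bundle_def)
  show "topspace M \<subseteq> fst ` null_bundle M A g"
  proof
    fix p assume p: "p \<in> topspace M"
    then obtain c W e where c: "c \<in> A" "openin M W" "p \<in> W" "W \<subseteq> fst c" "vierbein_on A g \<tau> W e"
      using exists_local_vierbein by blast
    have "orthonormal_basis A g p (\<lambda>a. e a p)" using c by (simp add: vierbein_on_def)
    moreover have "cone_param 1 (axis 1 1) \<in> split_null_cone"
      by (simp add: split_null_cone_components(1) null_cone_plus_def axis_eq_0_iff)
    ultimately have "(p, lin_comb (cone_param 1 (axis 1 1)) (\<lambda>a. e a p)) \<in> null_bundle M A g"
      using lin_comb_null_iff[of p e, OF p] by blast
    then show "p \<in> fst ` null_bundle M A g" by force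
  qed
qed

lemma frame_components_bij:
  assumes W: "openin M W" "vierbein_on A g \<tau> W e"
  shows "bij_betw (\<lambda>z. (fst z, frame_components e (fst z) (snd z)))
    {z \<in> null_bundle M A g. fst z \<in> W} (W \<times> split_null_cone)"
proof (rule bij_betw_byWitness[where f' = "\<lambda>(p, u). (p, lin_comb u (\<lambda>a. e a p))"])
  have e: "orthonormal_basis A g p (\<lambda>a. e a p)" "p \<in> topspace M" if "p \<in> W" for p
    using W that openin_subset[OF W(1)] by (auto simp: vierbein_on_def)
  show "\<forall>z\<in>{z \<in> null_bundle M A g. fst z \<in> W}.
      (case (fst z, frame_components e (fst z) (snd z)) of (p, u) \<Rightarrow> (p, lin_comb u (\<lambda>a. e a p))) = z"
    using null_bundle_frame_components(1)[OF W] by simp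
  show "\<forall>w\<in>W \<times> split_null_cone. (fst (case w of (p, u) \<Rightarrow> (p, lin_comb u (\<lambda>a. e a p))),
      frame_components e (fst (case w of (p, u) \<Rightarrow> (p, lin_comb u (\<lambda>a. e a p))))
        (snd (case w of (p, u) \<Rightarrow> (p, lin_comb u (\<lambda>a. e a p))))) = w"
    using frame_components_lin_comb[of _ e, OF e(1)] by auto
  show "(\<lambda>z. (fst z, frame_components e (fst z) (snd z))) ` {z \<in> null_bundle M A g. fst z \<in> W}
      \<subseteq> W \<times> split_null_cone"
    using null_bundle_frame_components(2)[OF W] by auto
  show "(\<lambda>(p, u). (p, lin_comb u (\<lambda>a. e a p))) ` (W \<times> split_null_cone)
      \<subseteq> {z \<in> null_bundle M A g. fst z \<in> W}"
    using lin_comb_null_iff[of _ e, OF e(2,1)] by auto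
qed

text \<open>Components in a vierbein over \<open>W\<close> give the trivialisation. The chart \<open>(\<phi>, spatial)\<close> of
  \<open>W \<times> split_null_cone\<close> on the component of sign \<open>\<sigma>\<close> pulls back to the null chart of \<open>\<sigma>\<close>, \<open>\<phi>\<close> and
  the same vierbein.\<close>

lemma null_bundle_local_triviality:
  assumes W: "openin M W" "vierbein_on A g \<tau> W e"
  shows "diffeomorphism (subtopology (null_bundle_topology M A g \<tau>) (fst -` W))
      (restrict_atlas (null_atlas M A g \<tau>) (fst -` W))
      (prod_topology (subtopology M W) (top_of_set split_null_cone))
      (prod_atlas (restrict_atlas A W) cone_atlas)
      (\<lambda>z. (fst z, frame_components e (fst z) (snd z)))"
proof (rule diffeomorphism_pullback_charts)
  have ts: "topspace (null_bundle_topology M A g \<tau>) \<inter> fst -` W = {z \<in> null_bundle M A g. fst z \<in> W}"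
    by (auto simp: null_bundle_topspace)
  have WM: "topspace M \<inter> W = W" using openin_subset[OF W(1)] by auto
  show "smooth_atlas (subtopology (null_bundle_topology M A g \<tau>) (fst -` W))
      (restrict_atlas (null_atlas M A g \<tau>) (fst -` W))"
    by (rule smooth_atlas_restrict_preimage[OF null_bundle_atlas(2)])
      (simp add: ts null_bundle_proj_open[OF W(1)])
  have R: "smooth_atlas (subtopology M W) (restrict_atlas A W)"
    by (rule smooth_atlas_restrict[OF atlas W(1)])
  show "\<Union>(fst ` prod_atlas (restrict_atlas A W) cone_atlas)
      = topspace (prod_topology (subtopology M W) (top_of_set split_null_cone))"
  proof -
    have "\<Union>(fst ` prod_atlas (restrict_atlas A W) cone_atlas)
        = \<Union>(fst ` restrict_atlas A W) \<times> \<Union>(fst ` cone_atlas)"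
      unfolding prod_atlas_def by force
    then show ?thesis using atlas_cover[OF R] atlas_cover[OF smooth_atlas_cone] by simp
  qed
  show "topological_chart (prod_topology (subtopology M W) (top_of_set split_null_cone)) d"
    if "d \<in> prod_atlas (restrict_atlas A W) cone_atlas" for d
    using that topological_chart_prod atlas_chart[OF R] atlas_chart[OF smooth_atlas_cone]
    unfolding prod_atlas_def by fastforce
  show "bij_betw (\<lambda>z. (fst z, frame_components e (fst z) (snd z)))
      (topspace (subtopology (null_bundle_topology M A g \<tau>) (fst -` W)))
      (topspace (prod_topology (subtopology M W) (top_of_set split_null_cone)))"
    using frame_components_bij[OF W] by (simp add: ts WM)
  fix d assume "d \<in> prod_atlas (restrict_atlas A W) cone_atlas"
  then obtain U \<phi> \<sigma> where U: "(U, \<phi>) \<in> A" and \<sigma>: "\<sigma> \<in> {1, -1}"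
    and d: "d = ((U \<inter> W) \<times> cone_param \<sigma> ` (- {0}), map_prod \<phi> spatial)"
    unfolding prod_atlas_def restrict_atlas_def cone_atlas_iff by auto
  define C where "C = null_chart M A g \<tau> \<sigma> (U \<inter> W) \<phi> e"
  have V: "openin M (U \<inter> W)"
    using chart_domain[OF atlas_chart[OF atlas U]] W(1) by auto
  have e: "vierbein_on A g \<tau> (U \<inter> W) e"
    by (rule vierbein_on_subset[OF W(2,1) V]) auto
  have "C = null_chart M A g \<tau> \<sigma> (U \<inter> W) (snd (U, \<phi>)) e" "U \<inter> W \<subseteq> fst (U, \<phi>)"
    by (simp_all add: C_def)
  then have C: "C \<in> null_atlas M A g \<tau>"
    unfolding null_atlas_iff using \<sigma> U V e by blast
  have dom: "{z \<in> topspace (subtopology (null_bundle_topology M A g \<tau>) (fst -` W)).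
      (fst z, frame_components e (fst z) (snd z)) \<in> fst d} = fst C \<inter> fst -` W"
    unfolding topspace_subtopology ts d C_def null_chart_domain
    using null_bundle_frame_components(3)[OF W _ _ \<sigma>] by auto
  have "(fst C \<inter> fst -` W, snd C) \<in> restrict_atlas (null_atlas M A g \<tau>) (fst -` W)"
    unfolding restrict_atlas_def by (rule image_eqI[OF _ C]) (simp add: case_prod_beta)
  moreover have "snd C z = snd d (fst z, frame_components e (fst z) (snd z))" for z
    by (simp add: C_def null_chart_def d case_prod_beta)
  ultimately show "\<exists>\<xi>. ({z \<in> topspace (subtopology (null_bundle_topology M A g \<tau>) (fst -` W)).
      (fst z, frame_components e (fst z) (snd z)) \<in> fst d}, \<xi>) \<in> restrict_atlas (null_atlas M A g \<tau>) (fst -` W) \<and>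
    (\<forall>z\<in>topspace (subtopology (null_bundle_topology M A g \<tau>) (fst -` W)).
      (fst z, frame_components e (fst z) (snd z)) \<in> fst d \<longrightarrow>
        \<xi> z = snd d (fst z, frame_components e (fst z) (snd z)))"
    unfolding dom by blast
qed

text \<open>The argument for local triviality on a single fibre: the slice charts are pullbacks of
  \<open>spatial\<close>.\<close>

lemma null_bundle_fibre:
  assumes p: "p \<in> topspace M"
  shows "diffeomorphic_manifolds (subtopology (null_bundle_topology M A g \<tau>) {z. fst z = p})
    (fibre_atlas (null_atlas M A g \<tau>) fst p) (top_of_set split_null_cone) cone_atlas"
proof -
  let ?E = "null_bundle_topology M A g \<tau>" and ?F = "{z :: 'a \<times> 'a tangent. fst z = p}"
  obtain c W e where c: "c \<in> A" "openin M W" "p \<in> W" "W \<subseteq> fst c" "vierbein_on A g \<tau> W e"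
    using exists_local_vierbein[OF p] by blast
  note W = c(2,5)
  have ts: "topspace (subtopology ?E ?F) = {z \<in> null_bundle M A g. fst z = p}"
    by (auto simp: null_bundle_topspace)
  have at: "smooth_atlas (subtopology ?E ?F) (fibre_atlas (null_atlas M A g \<tau>) fst p)"
  proof (rule smooth_atlas_fibre[OF null_bundle_atlas(2)])
    fix C assume "C \<in> null_atlas M A g \<tau>"
    then obtain \<sigma> d V f where C: "d \<in> A" "openin M V" "V \<subseteq> fst d"
      "C = null_chart M A g \<tau> \<sigma> V (snd d) f"
      unfolding null_atlas_iff by blast
    have "fst ` fst C \<subseteq> fst d" using C(3) by (auto simp: C(4) null_chart_domain)
    then have "inj_on (snd d) (fst ` fst C)"
      by (rule inj_on_subset[OF chart_inj[OF atlas_chart[OF atlas C(1)]]])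
    moreover have "\<forall>z\<in>fst C. fst (snd C z) = snd d (fst z)"
      by (simp add: C(4) null_chart_def case_prod_beta)
    ultimately show "\<exists>\<phi>. inj_on \<phi> (fst ` fst C) \<and> (\<forall>z\<in>fst C. fst (snd C z) = \<phi> (fst z))" by blast
  qed
  have man: "smooth_manifold (subtopology ?E ?F) (fibre_atlas (null_atlas M A g \<tau>) fst p)"
    unfolding smooth_manifold_def using at null_bundle_Hausdorff null_bundle_second_countable
    by (simp add: Hausdorff_space_subtopology second_countable_subtopology)
  have "diffeomorphism (subtopology ?E ?F) (fibre_atlas (null_atlas M A g \<tau>) fst p)
    (top_of_set split_null_cone) cone_atlas (\<lambda>z. frame_components e p (snd z))"
  proof (rule diffeomorphism_pullback_charts[OF at])
    show "\<Union>(fst ` cone_atlas) = topspace (top_of_set split_null_cone)"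
      by (rule atlas_cover[OF smooth_atlas_cone])
    show "topological_chart (top_of_set split_null_cone) d" if "d \<in> cone_atlas" for d
      by (rule atlas_chart[OF smooth_atlas_cone that])
    show "bij_betw (\<lambda>z. frame_components e p (snd z)) (topspace (subtopology ?E ?F))
        (topspace (top_of_set split_null_cone))"
    proof -
      have "inj_on (\<lambda>z. (fst z, frame_components e (fst z) (snd z))) {z \<in> null_bundle M A g. fst z \<in> W}"
        and im: "(\<lambda>z. (fst z, frame_components e (fst z) (snd z))) ` {z \<in> null_bundle M A g. fst z \<in> W}
          = W \<times> split_null_cone"
        using frame_components_bij[OF W] by (auto simp: bij_betw_def)
      then have "inj_on (\<lambda>z. frame_components e p (snd z)) {z \<in> null_bundle M A g. fst z = p}"
        using c(3) by (auto simp: inj_on_def)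
      moreover have "(\<lambda>z. frame_components e p (snd z)) ` {z \<in> null_bundle M A g. fst z = p} = split_null_cone"
      proof
        show "(\<lambda>z. frame_components e p (snd z)) ` {z \<in> null_bundle M A g. fst z = p} \<subseteq> split_null_cone"
          using null_bundle_frame_components(2)[OF W] c(3) by auto
        show "split_null_cone \<subseteq> (\<lambda>z. frame_components e p (snd z)) ` {z \<in> null_bundle M A g. fst z = p}"
        proof
          fix u assume "u \<in> split_null_cone"
          then have "(p, u) \<in> W \<times> split_null_cone" using c(3) by simp
          then obtain z where "z \<in> null_bundle M A g" "(p, u) = (fst z, frame_components e (fst z) (snd z))"
            unfolding im[symmetric] by auto
          then show "u \<in> (\<lambda>z. frame_components e p (snd z)) ` {z \<in> null_bundle M A g. fst z = p}"
            by (intro image_eqI[of _ _ z]) auto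
        qed
      qed
      ultimately show ?thesis unfolding ts by (simp add: bij_betw_def)
    qed
    fix d assume "d \<in> cone_atlas"
    then obtain \<sigma> where \<sigma>: "\<sigma> \<in> {1, -1}" and d: "d = (cone_param \<sigma> ` (- {0}), spatial)"
      unfolding cone_atlas_iff by blast
    define C where "C = null_chart M A g \<tau> \<sigma> W (snd c) e"
    have C: "C \<in> null_atlas M A g \<tau>"
      unfolding null_atlas_iff C_def using \<sigma> c by blast
    have dom: "{z \<in> topspace (subtopology ?E ?F). frame_components e p (snd z) \<in> fst d} = {z \<in> fst C. fst z = p}"
      unfolding ts d C_def null_chart_domain using null_bundle_frame_components(3)[OF W _ _ \<sigma>] c(3) by auto
    have "({z \<in> fst C. fst z = p}, snd \<circ> snd C) \<in> fibre_atlas (null_atlas M A g \<tau>) fst p"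
      unfolding fibre_atlas_def by (rule image_eqI[OF _ C]) (simp add: case_prod_beta)
    moreover have "(snd \<circ> snd C) z = snd d (frame_components e p (snd z))" if "fst z = p" for z
      using that by (simp add: C_def null_chart_def d case_prod_beta)
    ultimately show "\<exists>\<xi>. ({z \<in> topspace (subtopology ?E ?F). frame_components e p (snd z) \<in> fst d}, \<xi>)
        \<in> fibre_atlas (null_atlas M A g \<tau>) fst p \<and>
      (\<forall>z\<in>topspace (subtopology ?E ?F). frame_components e p (snd z) \<in> fst d \<longrightarrow>
        \<xi> z = snd d (frame_components e p (snd z)))"
      unfolding dom by (intro exI[of _ "snd \<circ> snd C"]) simp
  qed
  then show ?thesis
    unfolding diffeomorphic_manifolds_def using man smooth_manifold_cone by blast
qed

lemma null_bundle_fibre_bundle: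
  "smooth_fibre_bundle (null_bundle_topology M A g \<tau>) (null_atlas M A g \<tau>) M A
      (top_of_set split_null_cone) cone_atlas fst"
  unfolding smooth_fibre_bundle_def
proof (intro conjI ballI null_bundle_manifold manifold smooth_manifold_cone null_bundle_proj_smooth)
  show "fst ` topspace (null_bundle_topology M A g \<tau>) = topspace M"
    by (simp add: null_bundle_topspace null_bundle_proj_surj)
  fix p assume "p \<in> topspace M"
  then obtain c W e where c: "openin M W" "p \<in> W" "vierbein_on A g \<tau> W e"
    using exists_local_vierbein by blast
  from null_bundle_local_triviality[OF c(1,3)] c(1,2)
  show "\<exists>W \<Phi>. openin M W \<and> p \<in> W \<and>
        diffeomorphism (subtopology (null_bundle_topology M A g \<tau>) (fst -` W))
          (restrict_atlas (null_atlas M A g \<tau>) (fst -` W))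
          (prod_topology (subtopology M W) (top_of_set split_null_cone))
          (prod_atlas (restrict_atlas A W) cone_atlas) \<Phi> \<and>
        (\<forall>z\<in>topspace (null_bundle_topology M A g \<tau>). fst z \<in> W \<longrightarrow> fst (\<Phi> z) = fst z)"
    by (intro exI[of _ W] exI[of _ "\<lambda>z. (fst z, frame_components e (fst z) (snd z))"]) simp
qed

end

theorem proposition2p2:
  fixes M :: "'a topology" and A :: "'a chart4 set"
    and g :: "'a metric_field" and \<tau> :: "'a \<Rightarrow> 'a tangent"
  assumes "spacetime M A g \<tau>"
  shows "topspace (null_bundle_topology M A g \<tau>) = null_bundle M A g \<and>
    smooth_fibre_bundle (null_bundle_topology M A g \<tau>) (null_atlas M A g \<tau>) M A
      (top_of_set split_null_cone) cone_atlas fst \<and>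
    (\<forall>p\<in>topspace M.
       diffeomorphic_manifolds
         (subtopology (null_bundle_topology M A g \<tau>) {z. fst z = p})
         (fibre_atlas (null_atlas M A g \<tau>) fst p)
         (top_of_set split_null_cone) cone_atlas) \<and>
    split_null_cone = null_cone_plus \<union> null_cone_minus \<and>
    null_cone_plus \<inter> null_cone_minus = {}"
proof -
  interpret spacetime_manifold M A g \<tau>
    by unfold_locales (rule assms)
  show ?thesis
    using null_bundle_topspace null_bundle_fibre_bundle null_bundle_fibre split_null_cone_components
    by blast
qed

end
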